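(* The hypergraph $3\text{-}QI(11,2)$ has strong independence number $\alpha_S(3\text{-}QI(11,2))=26$ and strong chromatic number $\chi_S(3\text{-}QI(11,2))\ge 31$.
   Context: The hypergraph $3\text{-}QI(n,2)$ is the $3$-uniform hypergraph whose vertices are all partitions $\{P,\overline{P}\}$ of $\{1,\dots,n\}$ into two classes, each class of size at least $4$. Three distinct vertices $\{P,\overline P\},\{Q,\overline Q\},\{R,\overline R\}$ form a hyperedge if and only if they are $3$-qualitatively independent, i.e. all eight intersections $P'\cap Q'\cap R'$ with $P'\in\{P,\overline P\}$, $Q'\in\{Q,\overline Q\}$, $R'\in\{R,\overline R\}$ are nonempty. A strong $k$-colouring of a hypergraph $H$ is a partition of its vertex set into $k$ colour classes such that no two vertices belonging to a common hyperedge have the same colour; $\chi_S(H)$ is the minimum $k$ for which $H$ admits a strong $k$-colouring. A set $U$ of vertices is strongly independent if no hyperedge contains more than one vertex of $U$; $\alpha_S(H)$ is the maximum cardinality of a strongly independent set. *)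

theory Defs
  imports Main "HOL-Library.Disjoint_Sets"
begin

text \<open>A hypergraph is a pair of a vertex set and a set of hyperedges.\<close>

type_synonym 'a hypergraph = "'a set \<times> 'a set set"

abbreviation verts :: "'a hypergraph \<Rightarrow> 'a set" where
  "verts H \<equiv> fst H"

abbreviation edges :: "'a hypergraph \<Rightarrow> 'a set set" where
  "edges H \<equiv> snd H"

definition strong_colouring :: "'a hypergraph \<Rightarrow> nat \<Rightarrow> 'a set set \<Rightarrow> bool" where
  "strong_colouring H k \<C> \<longleftrightarrow>
     partition_on (verts H) \<C> \<and> finite \<C> \<and> card \<C> = k \<and>
     (\<forall>e\<in>edges H. \<forall>x\<in>e. \<forall>y\<in>e. x \<noteq> y \<longrightarrow> \<not> (\<exists>C\<in>\<C>. x \<in> C \<and> y \<in> C))"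

text \<open>The two parameters below are meaningful for hypergraphs with finitely many vertices:
  the minimum then exists (singleton colour classes), and so does the maximum.\<close>

definition strong_chromatic_number :: "'a hypergraph \<Rightarrow> nat" where
  "strong_chromatic_number H = (LEAST k. \<exists>\<C>. strong_colouring H k \<C>)"

definition strongly_independent :: "'a hypergraph \<Rightarrow> 'a set \<Rightarrow> bool" where
  "strongly_independent H U \<longleftrightarrow>
     U \<subseteq> verts H \<and> (\<forall>e\<in>edges H. \<forall>x\<in>e \<inter> U. \<forall>y\<in>e \<inter> U. x = y)"

definition strong_independence_number :: "'a hypergraph \<Rightarrow> nat" where
  "strong_independence_number H = Max {card U | U. strongly_independent H U}"

definition qualitatively_independent3 :: "'a set set \<Rightarrow> 'a set set \<Rightarrow> 'a set set \<Rightarrow> bool" where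
  "qualitatively_independent3 p q r \<longleftrightarrow>
     (\<forall>P\<in>p. \<forall>Q\<in>q. \<forall>R\<in>r. P \<inter> Q \<inter> R \<noteq> {})"

text \<open>A vertex is the unordered pair of the two classes of a partition, as a two-element set of
  sets.\<close>

definition QI3_verts :: "nat \<Rightarrow> nat set set set" where
  "QI3_verts n = {p. partition_on {1..n} p \<and> card p = 2 \<and> (\<forall>P\<in>p. card P \<ge> 4)}"

definition QI3_edges :: "nat \<Rightarrow> nat set set set set" where
  "QI3_edges n = {{p, q, r} | p q r.
     p \<in> QI3_verts n \<and> q \<in> QI3_verts n \<and> r \<in> QI3_verts n \<and>
     p \<noteq> q \<and> p \<noteq> r \<and> q \<noteq> r \<and> qualitatively_independent3 p q r}"

definition QI3 :: "nat \<Rightarrow> nat set set hypergraph" where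
  "QI3 n = (QI3_verts n, QI3_edges n)"

end

theory Submission
  imports Defs Complex_Main
begin

text \<open>
  A vertex of \<open>QI3 11\<close> is determined by its smaller class, a set \<open>A\<close> of four or five of the eleven
  points. Two vertices lie in a common hyperedge exactly when the four cells of their common
  refinement have at least two points each: the third partition has to split every cell, and
  conversely one point chosen from each cell gives a class of four points that splits them all. With
  eleven points this fails exactly when the two smaller classes are \<^emph>\<open>far\<close> (at most one common point)
  or \<^emph>\<open>near\<close> (their intersection misses at most one point of the smaller of the two). So the strong
  independence number is the maximum size of a \<^emph>\<open>compatible\<close> family: four- and five-element sets, any
  two of which are far or near.

  A family of 26 exists: on the points 1 to 11 take all \<open>{1,2,3,x}\<close> (8 sets), all \<open>{1,2,3,4,x}\<close>
  (7 sets), and, inside the six points 5 to 10, all five-element sets (6 sets) and the four-element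
  sets without the point 5 (5 sets).

  For the upper bound, observe first that nearness is transitive among the four-element members and
  among the five-element members, because two points in common already force near. A class of
  pairwise near five-element sets (a cluster) either has a common four-element \<^emph>\<open>core\<close> or lies in a
  six-element \<^emph>\<open>ball\<close>. There are at most two clusters, since three pairwise far five-element sets need
  twelve points (\<open>no_three_spread_blocks\<close>). The four-element members number at most 20
  (\<open>layer4_eleven_points\<close>): except for those inside at most two five-element blocks, each of them
  owns three pairs of points that no other four-element member contains, and there are only 55 pairs.
  So at most six five-element members make at most 26 sets; with seven or more, some cluster has at
  least four sets.

  If that cluster has a core \<open>D\<close> (\<open>core_cluster_bound\<close>), a member either contains \<open>D\<close> and has five
  elements (at most 7), or is a four-element set with three points in \<open>D\<close> (at most 8), or avoids \<open>D\<close>,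
  where compatible families on the remaining seven points have at most 11 members
  (\<open>compatible_seven_points\<close>); this is 26, and the few other sets that are possible when the cluster is
  small fit below this bound. If the cluster lies in a ball \<open>K\<close> (\<open>ball_cluster_bound\<close>), at most
  \<open>6 + 5\<close> members lie in \<open>K\<close> and all others have at most one point in \<open>K\<close>, hence all but at most one of
  their points among the five points outside; that leaves room for at most 15 of them.

  Finally every colour class is strongly independent, and there are \<open>330 + 462 = 792\<close> vertices, more
  than \<open>30 * 26 = 780\<close>.
\<close>

section \<open>Uniform families in which any two sets differ in one element\<close>

text \<open>
  A weak transitivity of having a large intersection: two subsets of \<open>B\<close> that are large enough must
  overlap.
\<close>

lemma card_Int_triangle:
  assumes "finite A" "finite B"
  shows "card (A \<inter> B) + card (B \<inter> C) \<le> card B + card (A \<inter> C)"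
proof -
  have "card (A \<inter> B) + card (B \<inter> C) = card ((A \<inter> B) \<union> (B \<inter> C)) + card ((A \<inter> B) \<inter> (B \<inter> C))"
    using assms by (intro card_Un_Int) auto
  also have "\<dots> \<le> card B + card (A \<inter> C)"
    using assms by (intro add_mono card_mono) auto
  finally show ?thesis .
qed

text \<open>
  Let \<open>A\<close> and \<open>B\<close> be two members. A member that does not contain \<open>A \<inter> B\<close> has to lie in \<open>A \<union> B\<close>. If
  there is such a member, a set containing \<open>A \<inter> B\<close> together with a point outside \<open>A \<union> B\<close> would meet
  it in too few points, so the whole family lies in \<open>A \<union> B\<close>.
\<close>

lemma adjacent_family_cases:
  assumes card_X: "\<And>A. A \<in> X \<Longrightarrow> card A = Suc r"
    and meet: "\<And>A B. A \<in> X \<Longrightarrow> B \<in> X \<Longrightarrow> A \<noteq> B \<Longrightarrow> card (A \<inter> B) = r"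
    and "X \<noteq> {}"
  obtains (core) D where "finite D" "card D = r" "\<And>A. A \<in> X \<Longrightarrow> D \<subseteq> A"
    | (ball) S where "finite S" "card S = r + 2" "\<And>A. A \<in> X \<Longrightarrow> A \<subseteq> S"
proof -
  have fin: "finite A" if "A \<in> X" for A
    using card_X[OF that] by (metis card.infinite nat.distinct(1))
  obtain A where A: "A \<in> X" using \<open>X \<noteq> {}\<close> by blast
  show thesis
  proof (cases "X = {A}")
    case True
    obtain D where "D \<subseteq> A" "card D = r" "finite D"
      using obtain_subset_with_card_n[of r A] card_X[OF A] by auto
    then show thesis using core True by blast
  next
    case False
    then obtain B where B: "B \<in> X" "B \<noteq> A" using A by blast
    define D S where "D = A \<inter> B" and "S = A \<union> B"
    have D: "card D = r" "finite D" using meet A B fin unfolding D_def by auto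
    have S: "card S = r + 2" "finite S"
      using card_Un_Int[of A B] card_X A B D fin unfolding S_def D_def by auto
    have sub_S: "C \<subseteq> S \<and> card (S - C) = 1" if C: "C \<in> X" "\<not> D \<subseteq> C" for C
    proof -
      have "C \<noteq> A" "C \<noteq> B" using C unfolding D_def by auto
      then have eq: "card (C \<inter> A) = r" "card (C \<inter> B) = r" using meet A B C by auto
      have "C \<inter> D \<subset> D" using C by auto
      then have "card (C \<inter> D) < r" using D psubset_card_mono by blast
      moreover have "card (C \<inter> S) + card (C \<inter> D) = card (C \<inter> A) + card (C \<inter> B)"
        using card_Un_Int[of "C \<inter> A" "C \<inter> B"] fin[OF C(1)] unfolding S_def D_def
        by (simp add: Int_Un_distrib Int_ac)
      ultimately have "card C \<le> card (C \<inter> S)" using eq card_X[OF C(1)] by linarith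
      then have "C \<inter> S = C" using fin[OF C(1)] by (intro card_seteq) auto
      then have "C \<subseteq> S" by blast
      moreover have "card (S - C) = 1"
        using card_Diff_subset[OF fin[OF C(1)] \<open>C \<subseteq> S\<close>] S card_X[OF C(1)] by simp
      ultimately show ?thesis by blast
    qed
    show thesis
    proof (cases "\<forall>C\<in>X. D \<subseteq> C")
      case True
      then show thesis using core D by blast
    next
      case False
      then obtain C where C: "C \<in> X" "\<not> D \<subseteq> C" by blast
      have "E \<subseteq> S" if E: "E \<in> X" for E
      proof (rule ccontr)
        assume notS: "\<not> E \<subseteq> S"
        then have "D \<subseteq> E" using sub_S E by blast
        have "C \<noteq> E" using notS sub_S[OF C] by blast
        obtain e where e: "e \<in> E" "e \<notin> S" using notS by blast
        have "D \<subset> E - {e} \<or> D = E - {e}" using e \<open>D \<subseteq> E\<close> unfolding D_def S_def by blast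
        then have "D = E - {e}"
          using D card_X[OF E] fin[OF E] e(1) psubset_card_mono[of "E - {e}" D] by auto
        then have "C \<inter> E \<subset> D" using sub_S[OF C] C e by blast
        then have "card (C \<inter> E) < r" using D psubset_card_mono by blast
        then show False using meet[OF C(1) E \<open>C \<noteq> E\<close>] by simp
      qed
      then show thesis using ball S by blast
    qed
  qed
qed

lemma card_family_over_core:
  assumes "finite V" "finite D" "card D = r" "\<And>A. A \<in> X \<Longrightarrow> card A = Suc r \<and> D \<subseteq> A \<and> A \<subseteq> V"
  shows "card X \<le> card (V - D)"
proof -
  have "X \<subseteq> (\<lambda>x. insert x D) ` (V - D)"
  proof
    fix A assume A: "A \<in> X"
    then have "card (A - D) = 1" using assms by (simp add: card_Diff_subset)
    then obtain x where "A - D = {x}" by (auto simp: card_1_singleton_iff)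
    then have "A = insert x D" "x \<in> V - D" using assms(4)[OF A] by auto
    then show "A \<in> (\<lambda>x. insert x D) ` (V - D)" by blast
  qed
  then show ?thesis using assms(1) surj_card_le by blast
qed

lemma card_family_in_ball:
  assumes "finite S" "card S = r + 2" "\<And>A. A \<in> X \<Longrightarrow> card A = Suc r \<and> A \<subseteq> S"
  shows "card X \<le> r + 2"
proof -
  have "X \<subseteq> {A. A \<subseteq> S \<and> card A = Suc r}" using assms by auto
  then have "card X \<le> card {A. A \<subseteq> S \<and> card A = Suc r}"
    using assms(1) by (intro card_mono) auto
  also have "\<dots> = (r + 2) choose Suc r" using n_subsets[OF assms(1)] assms(2) by simp
  also have "\<dots> = r + 2" using binomial_symmetric[of "Suc r" "r + 2"] by simp
  finally show ?thesis .
qed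

lemma card_adjacent_family:
  assumes "finite V" "\<And>A. A \<in> X \<Longrightarrow> A \<subseteq> V" "\<And>A. A \<in> X \<Longrightarrow> card A = Suc r"
    and "\<And>A B. A \<in> X \<Longrightarrow> B \<in> X \<Longrightarrow> A \<noteq> B \<Longrightarrow> card (A \<inter> B) = r"
  shows "card X \<le> max (r + 2) (card V - r)"
proof (cases "X = {}")
  case False
  consider (core) D where "finite D" "card D = r" "\<And>A. A \<in> X \<Longrightarrow> D \<subseteq> A"
    | (ball) S where "finite S" "card S = r + 2" "\<And>A. A \<in> X \<Longrightarrow> A \<subseteq> S"
    using adjacent_family_cases[OF assms(3,4) False] by blast
  then show ?thesis
  proof cases
    case (core D)
    obtain A where "A \<in> X" using False by blast
    then have "D \<subseteq> V" using core(3)[of A] assms(2)[of A] by blast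
    then have "card (V - D) = card V - r" using core by (simp add: card_Diff_subset)
    then show ?thesis
      using card_family_over_core[of V D r X] core assms by (simp add: le_max_iff_disj)
  next
    case (ball S)
    then show ?thesis using card_family_in_ball[of S r X] assms(3) by simp
  qed
qed simp

lemma card_Int_lt:
  assumes "finite A" "finite B" "card A = card B" "A \<noteq> B"
  shows "card (A \<inter> B) < card A"
proof -
  have "A \<inter> B \<noteq> A" using card_subset_eq[of B A] assms by auto
  then show ?thesis using assms(1) by (intro psubset_card_mono) auto
qed

text \<open>
  The form in which the bound for adjacent families is used for four-element sets: distinct sets
  that share more than two points share exactly three.
\<close>

lemma card_four_sets_meeting_twice:
  assumes "finite V" "\<And>A. A \<in> X \<Longrightarrow> A \<subseteq> V \<and> card A = 4"
    and "\<And>A B. A \<in> X \<Longrightarrow> B \<in> X \<Longrightarrow> card (A \<inter> B) > 2"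
  shows "card X \<le> max 5 (card V - 3)"
proof -
  have "card (A \<inter> B) = 3" if "A \<in> X" "B \<in> X" "A \<noteq> B" for A B
    using card_Int_lt[of A B] assms(2)[of A] assms(2)[of B] assms(3)[of A B] that assms(1)
    by (fastforce dest: finite_subset)
  then show ?thesis using card_adjacent_family[of V X 3] assms by simp
qed

section \<open>Pairs of points covered by four-element sets\<close>

definition pairs :: "'a set \<Rightarrow> 'a set set" where
  "pairs A = {e. e \<subseteq> A \<and> card e = 2}"

text \<open>
  The exceptional five-element sets of the pair count: all their pairs are covered by members of
  \<open>G\<close>, and only members inside the block contain such a pair. Up to five members share the ten pairs
  of a block, which can be less than three for each.
\<close>

definition saturated_blocks :: "'a set set \<Rightarrow> 'a set set" where
  "saturated_blocks G = {S. card S = 5 \<and> (\<forall>e\<in>pairs S. \<exists>A\<in>G. e \<subseteq> A) \<and>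
     (\<forall>A\<in>G. 2 \<le> card (A \<inter> S) \<longrightarrow> A \<subseteq> S)}"

definition private_pairs :: "'a set set \<Rightarrow> 'a set \<Rightarrow> 'a set set" where
  "private_pairs G A = {e \<in> pairs A. \<forall>B\<in>G. e \<subseteq> B \<longrightarrow> B = A}"

lemma saturated_inside:
  "S \<in> saturated_blocks G \<Longrightarrow> A \<in> G \<Longrightarrow> 2 \<le> card (A \<inter> S) \<Longrightarrow> A \<subseteq> S"
  unfolding saturated_blocks_def by simp

lemma saturated_cover:
  assumes "S \<in> saturated_blocks G" "e \<in> pairs S"
  obtains A where "A \<in> G" "e \<subseteq> A"
  using assms unfolding saturated_blocks_def by blast

lemma saturated_card: "S \<in> saturated_blocks G \<Longrightarrow> card S = 5 \<and> finite S"
  unfolding saturated_blocks_def by (simp add: card_ge_0_finite)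

lemma finite_pairs: "finite A \<Longrightarrow> finite (pairs A)"
  unfolding pairs_def by simp

lemma card_pairs: "finite A \<Longrightarrow> card (pairs A) = card A choose 2"
  unfolding pairs_def by (simp add: n_subsets)

lemma pair_subset: "e \<in> pairs A \<Longrightarrow> e \<subseteq> A"
  unfolding pairs_def by blast

lemma pairs_mono: "A \<subseteq> B \<Longrightarrow> pairs A \<subseteq> pairs B"
  unfolding pairs_def by blast

lemma common_pair_imp_card_Int:
  assumes "finite A" "e \<in> pairs A" "e \<subseteq> B"
  shows "2 \<le> card (A \<inter> B)"
proof -
  have "card e \<le> card (A \<inter> B)" using assms unfolding pairs_def by (intro card_mono) auto
  then show ?thesis using assms(2) by (simp add: pairs_def)
qed

lemma card_Int_imp_common_pair:
  assumes "2 \<le> card (A \<inter> B)"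
  obtains e where "e \<in> pairs A" "e \<in> pairs B"
proof -
  obtain e where "e \<subseteq> A \<inter> B" "card e = 2"
    using obtain_subset_with_card_n[OF assms] by blast
  then show thesis using that unfolding pairs_def by blast
qed

text \<open>
  Among the members that are near \<open>A\<close>, each omits one point of \<open>A\<close>. If all of them omit the same
  point \<open>a\<close>, the three pairs of \<open>A\<close> at \<open>a\<close> are private. Otherwise two of them omit different points;
  both then add the same point \<open>x\<close>, and the three sets are \<open>insert x A\<close> with one point removed,
  which covers every pair of \<open>insert x A\<close>.
\<close>

lemma saturated_or_private:
  assumes card_G: "\<And>A. A \<in> G \<Longrightarrow> card A = 4"
    and no_two: "\<And>A B. A \<in> G \<Longrightarrow> B \<in> G \<Longrightarrow> card (A \<inter> B) \<noteq> 2"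
    and A: "A \<in> G"
  shows "(\<exists>S\<in>saturated_blocks G. A \<subseteq> S) \<or> 3 \<le> card (private_pairs G A)"
proof (cases "\<exists>a\<in>A. \<forall>B\<in>G. B \<noteq> A \<longrightarrow> 2 \<le> card (A \<inter> B) \<longrightarrow> a \<notin> B")
  have fin: "finite B" if "B \<in> G" for B using card_G[OF that] by (simp add: card_ge_0_finite)
  have three: "card (B \<inter> C) = 3" if "B \<in> G" "C \<in> G" "B \<noteq> C" "2 \<le> card (B \<inter> C)" for B C
    using card_Int_lt[of B C] no_two[of B C] card_G[OF that(1)] card_G[OF that(2)] fin that by force
  {
    case True
    then obtain a where a: "a \<in> A" "\<And>B. B \<in> G \<Longrightarrow> B \<noteq> A \<Longrightarrow> 2 \<le> card (A \<inter> B) \<Longrightarrow> a \<notin> B"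
      by blast
    have "(\<lambda>t. {a, t}) ` (A - {a}) \<subseteq> private_pairs G A"
    proof
      fix e assume "e \<in> (\<lambda>t. {a, t}) ` (A - {a})"
      then have e: "e \<in> pairs A" "a \<in> e" using a(1) unfolding pairs_def by auto
      then show "e \<in> private_pairs G A"
        using a(2) common_pair_imp_card_Int[OF fin[OF A] e(1)] unfolding private_pairs_def by blast
    qed
    moreover have "inj_on (\<lambda>t. {a, t}) (A - {a})" by (auto simp: inj_on_def doubleton_eq_iff)
    moreover have "card (A - {a}) = 3" using a(1) card_G[OF A] fin[OF A] by simp
    moreover have "finite (private_pairs G A)"
      using finite_pairs[OF fin[OF A]] unfolding private_pairs_def by simp
    ultimately have "3 \<le> card (private_pairs G A)" by (metis card_image card_mono)
    then show ?thesis by blast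
  next
    case False
    then have nbr: "\<exists>B\<in>G. B \<noteq> A \<and> card (A \<inter> B) = 3 \<and> a \<in> B" if "a \<in> A" for a
      using three[OF A] that by metis
    have miss: "\<exists>b x. A - B = {b} \<and> B - A = {x} \<and> B = insert x (A - {b})"
      if B: "B \<in> G" "card (A \<inter> B) = 3" for B
    proof -
      have "card (A - B) = 1" "card (B - A) = 1"
        using B card_Diff_subset_Int[of A B] card_Diff_subset_Int[of B A] fin A card_G
        by (auto simp: Int_commute)
      then obtain b x where "A - B = {b}" "B - A = {x}" by (auto simp: card_1_singleton_iff)
      then show ?thesis by blast
    qed
    have "A \<noteq> {}" using card_G[OF A] by auto
    then obtain a where "a \<in> A" by blast
    then obtain B where B: "B \<in> G" "B \<noteq> A" "card (A \<inter> B) = 3" using nbr by blast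
    obtain b x where b: "A - B = {b}" and x: "B - A = {x}" and B_eq: "B = insert x (A - {b})"
      using miss[OF B(1,3)] by blast
    obtain C where C: "C \<in> G" "C \<noteq> A" "card (A \<inter> C) = 3" "b \<in> C"
      using nbr[of b] b by blast
    obtain c y where c: "A - C = {c}" and y: "C - A = {y}" and C_eq: "C = insert y (A - {c})"
      using miss[OF C(1,3)] by blast
    have "b \<noteq> c" using c C(4) by blast
    have "B \<noteq> C" using b C(4) by blast
    have "y = x"
    proof (rule ccontr)
      assume "y \<noteq> x"
      then have "B \<inter> C = A - {b, c}" using B_eq C_eq b c x y by auto
      moreover have "card (A - {b, c}) = 2"
        using card_G[OF A] \<open>b \<noteq> c\<close> b c fin[OF A] by (subst card_Diff_subset) auto
      ultimately show False using no_two[OF B(1) C(1)] by simp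
    qed
    define S where "S = insert x A"
    have S_minus: "A = S - {x}" "B = S - {b}" "C = S - {c}"
      using B_eq C_eq b c x y \<open>y = x\<close> unfolding S_def by auto
    have bcx: "b \<noteq> x" "c \<noteq> x" "{b, c, x} \<subseteq> S" using b c x unfolding S_def by auto
    have S: "card S = 5" "finite S"
      using card_G[OF A] fin[OF A] x unfolding S_def by (auto simp: card_insert_if)
    have cover: "e \<subseteq> A \<or> e \<subseteq> B \<or> e \<subseteq> C" if "e \<in> pairs S" for e
    proof (rule ccontr)
      assume "\<not> ?thesis"
      then have "{x, b, c} \<subseteq> e" using that S_minus unfolding pairs_def by blast
      moreover have "finite e" using that S(2) unfolding pairs_def by (auto dest: finite_subset)
      ultimately have "card {x, b, c} \<le> card e" by (intro card_mono)
      then show False using that bcx \<open>b \<noteq> c\<close> unfolding pairs_def by simp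
    qed
    have inside: "E \<subseteq> S" if E: "E \<in> G" "2 \<le> card (E \<inter> S)" for E
    proof (rule ccontr)
      assume notS: "\<not> E \<subseteq> S"
      have neq: "E \<noteq> A" "E \<noteq> B" "E \<noteq> C" using notS S_minus by auto
      have small: "card (E \<inter> S) \<le> 3"
      proof -
        have "E \<inter> S \<subset> E" using notS by blast
        then show ?thesis using psubset_card_mono[of E "E \<inter> S"] fin[OF E(1)] card_G[OF E(1)] by simp
      qed
      have finES: "finite (E \<inter> S)" using S(2) by simp
      have eqI: "E \<inter> M = E \<inter> S" if M: "M \<in> {A, B, C}" "2 \<le> card (E \<inter> M)" for M
      proof -
        have "card (E \<inter> M) = 3" using three[of E M] E M neq A B C by auto
        moreover have "E \<inter> M \<subseteq> E \<inter> S" using M(1) S_minus by blast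
        ultimately show ?thesis using small finES card_seteq[of "E \<inter> S" "E \<inter> M"] by simp
      qed
      obtain e where e: "e \<in> pairs E" "e \<in> pairs S" using card_Int_imp_common_pair[OF E(2)] .
      obtain M where M: "M \<in> {A, B, C}" "e \<subseteq> M" using cover[OF e(2)] by auto
      have "2 \<le> card (E \<inter> M)" using common_pair_imp_card_Int[OF fin[OF E(1)] e(1) M(2)] .
      moreover have "M \<in> G" "E \<noteq> M" using M(1) neq A B(1) C(1) by auto
      ultimately have "card (E \<inter> M) = 3" using three[OF E(1)] by simp
      then have c3: "card (E \<inter> S) = 3" using eqI[OF M(1)] by simp
      have "E \<inter> M' = E \<inter> S" if M': "M' \<in> {A, B, C}" for M'
      proof (rule eqI[OF M'])
        obtain m where "M' = S - {m}" using M' S_minus by blast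
        then have "E \<inter> S \<subseteq> insert m (E \<inter> M')" by blast
        moreover have "finite (E \<inter> M')" using fin[OF E(1)] by simp
        ultimately have "card (E \<inter> S) \<le> card (insert m (E \<inter> M'))" by (intro card_mono) auto
        also have "\<dots> \<le> Suc (card (E \<inter> M'))" by (rule card_insert_le_m1) auto
        finally show "2 \<le> card (E \<inter> M')" using c3 by simp
      qed
      then have "E \<inter> A = E \<inter> S" "E \<inter> B = E \<inter> S" "E \<inter> C = E \<inter> S" by auto
      then have "E \<inter> S \<subseteq> S - {x, b, c}" using S_minus by blast
      moreover have "card (S - {x, b, c}) = 2"
        using S bcx \<open>b \<noteq> c\<close> by (subst card_Diff_subset) auto
      ultimately show False using c3 S(2) card_mono[of "S - {x, b, c}" "E \<inter> S"] by simp
    qed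
    have "\<exists>M\<in>G. e \<subseteq> M" if "e \<in> pairs S" for e using cover[OF that] A B(1) C(1) by auto
    then have "S \<in> saturated_blocks G"
      unfolding saturated_blocks_def using S(1) inside by simp
    then show ?thesis unfolding S_def by blast
  }
qed

lemma saturated_blocks_subset:
  assumes "\<And>A. A \<in> G \<Longrightarrow> A \<subseteq> V" "S \<in> saturated_blocks G"
  shows "S \<subseteq> V"
proof
  fix x assume x: "x \<in> S"
  have "S \<noteq> {x}" using assms(2) unfolding saturated_blocks_def by auto
  then obtain y where "y \<in> S - {x}" using x by blast
  then have "{x, y} \<in> pairs S" using x unfolding pairs_def by auto
  then show "x \<in> V" using assms unfolding saturated_blocks_def by blast
qed

text \<open>
  A pair common to both blocks is covered by a member \<open>A\<close> inside both of them. Let \<open>x\<close> be a point of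
  \<open>S - S'\<close>. A member covering \<open>x\<close> and a point of \<open>A\<close> lies in \<open>S\<close>, hence shares three points with
  \<open>A \<subseteq> S'\<close>, hence would lie in \<open>S'\<close>, which does not contain \<open>x\<close>.
\<close>

lemma saturated_blocks_meet:
  assumes card_G: "\<And>A. A \<in> G \<Longrightarrow> card A = 4"
    and S: "S \<in> saturated_blocks G" and S': "S' \<in> saturated_blocks G" and "S \<noteq> S'"
  shows "card (S \<inter> S') \<le> 1"
proof (rule ccontr)
  assume "\<not> ?thesis"
  then have "2 \<le> card (S \<inter> S')" by simp
  then obtain e where e: "e \<in> pairs S" "e \<in> pairs S'" by (rule card_Int_imp_common_pair)
  have fin: "finite B" if "B \<in> G" for B using card_G[OF that] by (simp add: card_ge_0_finite)
  have in_both: "A \<subseteq> S \<and> A \<subseteq> S'" if "A \<in> G" "f \<in> pairs S" "f \<in> pairs S'" "f \<subseteq> A" for A f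
  proof -
    have "f \<in> pairs A" using that unfolding pairs_def by blast
    then have "2 \<le> card (A \<inter> S)" "2 \<le> card (A \<inter> S')"
      using common_pair_imp_card_Int[OF fin[OF that(1)]] that(2,3) pair_subset by metis+
    then show ?thesis using saturated_inside[OF S that(1)] saturated_inside[OF S' that(1)] by simp
  qed
  obtain A where A: "A \<in> G" "e \<subseteq> A" using saturated_cover[OF S e(1)] by blast
  have AS: "A \<subseteq> S" "A \<subseteq> S'" using in_both A e by blast+
  have finS: "finite S" "finite S'" "card S = 5" "card S' = 5"
    using saturated_card[OF S] saturated_card[OF S'] by simp_all
  have "\<not> S \<subseteq> S'" using finS \<open>S \<noteq> S'\<close> card_subset_eq[of S' S] by auto
  then obtain x where x: "x \<in> S" "x \<notin> S'" by blast
  have "A \<noteq> {}" using card_G[OF A(1)] by auto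
  then obtain a where a: "a \<in> A" by blast
  have "x \<noteq> a" using x(2) a AS(2) by blast
  then have "{x, a} \<in> pairs S" using x a AS unfolding pairs_def by auto
  then obtain B where B: "B \<in> G" "{x, a} \<subseteq> B" using saturated_cover[OF S] by blast
  have "2 \<le> card (B \<inter> S)"
    using common_pair_imp_card_Int[of B "{x,a}" S] fin[OF B(1)] B \<open>{x, a} \<in> pairs S\<close>
    unfolding pairs_def by auto
  then have BS: "B \<subseteq> S" using saturated_inside[OF S B(1)] by simp
  have "card (A \<union> B) \<le> 5" using AS(1) BS finS card_mono[of S "A \<union> B"] by simp
  then have "2 \<le> card (A \<inter> B)"
    using card_Un_Int[OF fin[OF A(1)] fin[OF B(1)]] card_G A(1) B(1) by simp
  then have "2 \<le> card (B \<inter> S')"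
    using card_mono[of "B \<inter> S'" "A \<inter> B"] AS(2) fin[OF B(1)] by force
  then have "B \<subseteq> S'" using saturated_inside[OF S' B(1)] by simp
  then show False using B(2) x(2) by blast
qed

text \<open>
  The private pairs of members outside all blocks and the pairs of the blocks are disjoint sets of
  pairs. A block uses ten pairs for at most five members, so it costs five pairs less than the three
  per member that the others use.
\<close>

lemma private_pair_count:
  fixes G :: "'a set set"
  assumes "finite V" and sub: "\<And>A. A \<in> G \<Longrightarrow> A \<subseteq> V"
    and card_G: "\<And>A. A \<in> G \<Longrightarrow> card A = 4"
    and no_two: "\<And>A B. A \<in> G \<Longrightarrow> B \<in> G \<Longrightarrow> card (A \<inter> B) \<noteq> 2"
  shows "3 * card G \<le> (card V choose 2) + 5 * card (saturated_blocks G)"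
proof -
  define SB where "SB = saturated_blocks G"
  define G1 where "G1 = {A \<in> G. \<exists>S\<in>SB. A \<subseteq> S}"
  define G2 where "G2 = G - G1"
  have "G \<subseteq> Pow V" using sub by blast
  then have finG: "finite G" using assms(1) by (simp add: finite_subset)
  have fin: "finite A" if "A \<in> G" for A using sub[OF that] assms(1) finite_subset by blast
  have SB_V: "S \<subseteq> V" if "S \<in> SB" for S
    using saturated_blocks_subset[OF sub] that unfolding SB_def by blast
  have finSB: "finite SB" using assms(1) SB_V finite_subset[of SB "Pow V"] by (simp add: subset_iff)
  have S5: "card S = 5" "finite S" if "S \<in> SB" for S
    using that saturated_card unfolding SB_def by blast+
  have priv: "3 \<le> card (private_pairs G A)" if "A \<in> G2" for A
  proof -
    have "A \<in> G" using that unfolding G2_def by blast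
    then have "(\<exists>S\<in>saturated_blocks G. A \<subseteq> S) \<or> 3 \<le> card (private_pairs G A)"
      using card_G no_two by (intro saturated_or_private)
    then show ?thesis using that unfolding G2_def G1_def SB_def by blast
  qed
  have fin_priv: "finite (private_pairs G A)" if "A \<in> G" for A
    using finite_pairs[OF fin[OF that]] unfolding private_pairs_def by simp
  have "card G1 \<le> card (\<Union>S\<in>SB. {A. A \<subseteq> S \<and> card A = 4})"
  proof (rule card_mono)
    show "finite (\<Union>S\<in>SB. {A. A \<subseteq> S \<and> card A = 4})" using finSB S5 by auto
    show "G1 \<subseteq> (\<Union>S\<in>SB. {A. A \<subseteq> S \<and> card A = 4})" using card_G unfolding G1_def by blast
  qed
  also have "\<dots> \<le> (\<Sum>S\<in>SB. card {A. A \<subseteq> S \<and> card A = 4})" using finSB by (rule card_UN_le)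
  also have "\<dots> = (\<Sum>S\<in>SB. 5)"
    using S5 by (intro sum.cong) (auto simp: n_subsets numeral_eq_Suc)
  finally have G1: "card G1 \<le> 5 * card SB" by simp
  have disj1: "private_pairs G A \<inter> private_pairs G B = {}" if "A \<in> G2" "B \<in> G2" "A \<noteq> B" for A B
    using that unfolding private_pairs_def pairs_def G2_def by blast
  have disj2: "pairs S \<inter> pairs S' = {}" if "S \<in> SB" "S' \<in> SB" "S \<noteq> S'" for S S'
  proof (rule ccontr)
    assume "pairs S \<inter> pairs S' \<noteq> {}"
    then have "2 \<le> card (S \<inter> S')"
      using common_pair_imp_card_Int[OF S5(2)[OF that(1)]] pair_subset by blast
    moreover have "card (S \<inter> S') \<le> 1"
      using card_G that unfolding SB_def by (intro saturated_blocks_meet)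
    ultimately show False by simp
  qed
  have disj3: "private_pairs G A \<inter> pairs S = {}" if "A \<in> G2" "S \<in> SB" for A S
  proof (rule ccontr)
    have A: "A \<in> G" using that unfolding G2_def by blast
    assume "private_pairs G A \<inter> pairs S \<noteq> {}"
    then obtain e where "e \<in> pairs A" "e \<subseteq> S" unfolding private_pairs_def pairs_def by blast
    then have "2 \<le> card (A \<inter> S)" using common_pair_imp_card_Int fin[OF A] by blast
    then have "A \<subseteq> S" using saturated_inside that A unfolding SB_def by blast
    then show False using that unfolding G2_def G1_def by blast
  qed
  have G2_G: "A \<in> G" if "A \<in> G2" for A using that unfolding G2_def by blast
  have finG2: "finite G2" using finG unfolding G2_def by simp
  have "3 * card G2 \<le> (\<Sum>A\<in>G2. card (private_pairs G A))"
    using sum_mono[of G2 "\<lambda>_. 3" "\<lambda>A. card (private_pairs G A)"] priv by (simp add: mult.commute)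
  also have "\<dots> = card (\<Union>A\<in>G2. private_pairs G A)"
    using finG2 fin_priv G2_G disj1 by (subst card_UN_disjoint) auto
  finally have c2: "3 * card G2 \<le> card (\<Union>A\<in>G2. private_pairs G A)" .
  have "10 * card SB = (\<Sum>S\<in>SB. card (pairs S))"
    using S5 by (simp add: card_pairs numeral_eq_Suc)
  also have "\<dots> = card (\<Union>S\<in>SB. pairs S)"
    using finSB S5 finite_pairs disj2 by (subst card_UN_disjoint) auto
  finally have c1: "10 * card SB = card (\<Union>S\<in>SB. pairs S)" .
  have "card (\<Union>A\<in>G2. private_pairs G A) + card (\<Union>S\<in>SB. pairs S)
      = card ((\<Union>A\<in>G2. private_pairs G A) \<union> (\<Union>S\<in>SB. pairs S))"
  proof (rule card_Un_disjoint[symmetric])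
    show "finite (\<Union>A\<in>G2. private_pairs G A)" using finG2 fin_priv G2_G by blast
    show "finite (\<Union>S\<in>SB. pairs S)" using finSB S5(2) finite_pairs by blast
    show "(\<Union>A\<in>G2. private_pairs G A) \<inter> (\<Union>S\<in>SB. pairs S) = {}" using disj3 by blast
  qed
  also have "\<dots> \<le> card (pairs V)"
  proof (rule card_mono[OF finite_pairs[OF assms(1)]])
    have "private_pairs G A \<subseteq> pairs V" if "A \<in> G2" for A
      using pairs_mono[OF sub[OF G2_G[OF that]]] unfolding private_pairs_def by blast
    moreover have "pairs S \<subseteq> pairs V" if "S \<in> SB" for S using pairs_mono SB_V that by blast
    ultimately show "(\<Union>A\<in>G2. private_pairs G A) \<union> (\<Union>S\<in>SB. pairs S) \<subseteq> pairs V" by blast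
  qed
  finally have "3 * card G2 + 10 * card SB \<le> card V choose 2"
    unfolding card_pairs[OF assms(1)] using c1 c2 by linarith
  moreover have "card G = card G1 + card G2"
  proof -
    have "G = G1 \<union> G2" "G1 \<inter> G2 = {}" unfolding G2_def G1_def by auto
    then show ?thesis using finG by (metis card_Un_disjoint finite_Un)
  qed
  ultimately show ?thesis using G1 unfolding SB_def by linarith
qed

section \<open>Compatible families\<close>

text \<open>
  Any two members are far (first alternative) or near (second alternative).
\<close>

definition compatible_family :: "'a set set \<Rightarrow> bool" where
  "compatible_family F \<longleftrightarrow> (\<forall>A\<in>F. card A = 4 \<or> card A = 5) \<and>
     (\<forall>A\<in>F. \<forall>B\<in>F. A \<noteq> B \<longrightarrow> card (A \<inter> B) \<le> 1 \<or> min (card A) (card B) \<le> Suc (card (A \<inter> B)))"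

abbreviation layer :: "nat \<Rightarrow> 'a set set \<Rightarrow> 'a set set" where
  "layer k F \<equiv> {A \<in> F. card A = k}"

lemma compatible_family_subset: "compatible_family F \<Longrightarrow> F' \<subseteq> F \<Longrightarrow> compatible_family F'"
  unfolding compatible_family_def by blast

lemma compatible_card: "compatible_family F \<Longrightarrow> A \<in> F \<Longrightarrow> card A = 4 \<or> card A = 5"
  unfolding compatible_family_def by blast

lemma compatible_finite: "compatible_family F \<Longrightarrow> A \<in> F \<Longrightarrow> finite A"
  using compatible_card[of F A] card.infinite[of A] by fastforce

lemma compatible_near:
  assumes "compatible_family F" "A \<in> F" "B \<in> F" "2 \<le> card (A \<inter> B)"
  shows "min (card A) (card B) \<le> Suc (card (A \<inter> B))"
proof (cases "A = B")
  case False
  then have "card (A \<inter> B) \<le> 1 \<or> min (card A) (card B) \<le> Suc (card (A \<inter> B))"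
    using assms(1-3) unfolding compatible_family_def by blast
  then show ?thesis using assms(4) by linarith
qed simp

text \<open>
  Near sets have at least three common points, so an intersection of exactly two points never
  occurs.
\<close>

lemma compatible_near3:
  assumes "compatible_family F" "A \<in> F" "B \<in> F" "2 \<le> card (A \<inter> B)"
  shows "3 \<le> card (A \<inter> B)"
  using compatible_near[OF assms] compatible_card[OF assms(1,2)] compatible_card[OF assms(1,3)] by auto

lemma compatible_near4:
  assumes "compatible_family F" "A \<in> layer 5 F" "B \<in> layer 5 F" "2 \<le> card (A \<inter> B)"
  shows "4 \<le> card (A \<inter> B)"
  using compatible_near[of F A B] assms by auto

lemma near_layer5_eq:
  assumes "compatible_family F" "A \<in> layer 5 F" "B \<in> layer 5 F" "A \<noteq> B" "2 \<le> card (A \<inter> B)"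
  shows "card (A \<inter> B) = 4"
  using compatible_near4[OF assms(1-3,5)] card_Int_lt[of A B] assms compatible_finite[OF assms(1)]
  by auto

lemma near_layer4_trans:
  assumes "compatible_family F" "A \<in> layer 4 F" "B \<in> layer 4 F" "C \<in> layer 4 F"
    and "2 \<le> card (A \<inter> B)" "2 \<le> card (B \<inter> C)"
  shows "2 < card (A \<inter> C)"
proof -
  have "3 \<le> card (A \<inter> B)" "3 \<le> card (B \<inter> C)" using compatible_near3[OF assms(1)] assms by auto
  moreover have "card (A \<inter> B) + card (B \<inter> C) \<le> card B + card (A \<inter> C)"
    using assms compatible_finite[OF assms(1)] by (intro card_Int_triangle) auto
  ultimately have "2 \<le> card (A \<inter> C)" using assms(3) by simp
  then show ?thesis using compatible_near3[OF assms(1), of A C] assms by simp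
qed

lemma card_split_layers:
  assumes "compatible_family F" "finite F"
  shows "card F = card (layer 4 F) + card (layer 5 F)"
proof -
  have "F = layer 4 F \<union> layer 5 F" using compatible_card[OF assms(1)] by blast
  moreover have "card (layer 4 F \<union> layer 5 F) = card (layer 4 F) + card (layer 5 F)"
    using assms(2) by (intro card_Un_disjoint) auto
  ultimately show ?thesis by simp
qed

lemma card_Int_ge:
  assumes "finite Q" "finite A"
  shows "card (A \<inter> Q) + card (B \<inter> Q) \<le> card Q + card (A \<inter> B)"
  using card_Int_triangle[of A Q B] assms by (simp add: Int_commute)

section \<open>Four-element members\<close>

lemma layer4_pair_count:
  assumes "compatible_family F" "finite V" "F \<subseteq> Pow V"
  shows "3 * card (layer 4 F) \<le> (card V choose 2) + 5 * card (saturated_blocks (layer 4 F))"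
proof (rule private_pair_count[OF assms(2)])
  show "card (A \<inter> B) \<noteq> 2" if "A \<in> layer 4 F" "B \<in> layer 4 F" for A B
    using compatible_near3[OF assms(1), of A B] that by auto
qed (use assms(3) in auto)

lemma saturated_layer4:
  assumes "F \<subseteq> Pow V" "S \<in> saturated_blocks (layer 4 F)"
  shows "S \<subseteq> V \<and> card S = 5 \<and> finite S"
  using saturated_card[OF assms(2)] saturated_blocks_subset[OF _ assms(2), of V] assms(1) by blast

lemma saturated_layer4_meet:
  assumes "S \<in> saturated_blocks (layer 4 F)" "S' \<in> saturated_blocks (layer 4 F)" "S \<noteq> S'"
  shows "card (S \<inter> S') \<le> 1"
  using saturated_blocks_meet[OF _ assms] by simp

text \<open>
  Two saturated blocks would need nine points, so the pair count gives \<open>3 * card \<le> 21 + 5\<close>.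
\<close>

lemma layer4_seven_points:
  assumes "compatible_family F" "F \<subseteq> Pow E" "finite E" "card E = 7"
  shows "card (layer 4 F) \<le> 8"
proof -
  define SB where "SB = saturated_blocks (layer 4 F)"
  have "S = S'" if S: "S \<in> SB" "S' \<in> SB" for S S'
  proof (rule ccontr)
    assume "S \<noteq> S'"
    then have "card (S \<inter> S') \<le> 1" using saturated_layer4_meet S unfolding SB_def by blast
    moreover have "S \<subseteq> E" "card S = 5" "finite S" "S' \<subseteq> E" "card S' = 5" "finite S'"
      using saturated_layer4[OF assms(2)] S unfolding SB_def by blast+
    moreover from this have "card (S \<union> S') \<le> 7"
      using card_mono[of E "S \<union> S'"] assms(3,4) by simp
    ultimately show False using card_Un_Int[of S S'] by linarith
  qed
  then have "card SB \<le> 1" by (metis One_nat_def card_le_Suc0_iff_eq card.infinite zero_le_one)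
  then show ?thesis
    using layer4_pair_count[OF assms(1,3,2)] assms(4) unfolding SB_def by (simp add: numeral_eq_Suc)
qed

text \<open>
  Three such blocks would cover at least \<open>5 + 4 + 3 = 12\<close> points.
\<close>

lemma no_three_spread_blocks:
  assumes "finite V" "card V = 11" "A \<subseteq> V" "B \<subseteq> V" "C \<subseteq> V" "card A = 5" "card B = 5" "card C = 5"
    and "card (A \<inter> B) \<le> 1" "card (A \<inter> C) \<le> 1" "card (B \<inter> C) \<le> 1"
  shows False
proof -
  have fin: "finite A" "finite B" "finite C" using assms finite_subset by auto
  have "card (A \<union> B) \<ge> 9" using card_Un_Int[OF fin(1,2)] assms by linarith
  moreover have "card ((A \<union> B) \<inter> C) \<le> 2"
    using card_Un_le[of "A \<inter> C" "B \<inter> C"] assms by (simp add: Int_Un_distrib2)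
  moreover have "card (A \<union> B \<union> C) \<le> 11"
    using card_mono[of V "A \<union> B \<union> C"] assms by simp
  ultimately show False using card_Un_Int[of "A \<union> B" C] fin assms by simp
qed

text \<open>
  The pair count gives 20 if there is at most one saturated block. Two blocks \<open>S\<close> and \<open>T\<close> cover at
  least nine points, so every further member contains the two remaining points; these members
  pairwise share two points, hence are pairwise near, and there are at most 8 of them besides the 10
  inside \<open>S\<close> and \<open>T\<close>.
\<close>

lemma layer4_eleven_points:
  assumes F: "compatible_family F" "F \<subseteq> Pow V" and V: "finite V" "card V = 11"
  shows "card (layer 4 F) \<le> 20"
proof -
  define G where "G = layer 4 F"
  define SB where "SB = saturated_blocks G"
  have count: "3 * card G \<le> 55 + 5 * card SB"
    using layer4_pair_count[OF F(1) V(1) F(2)] V(2) unfolding SB_def G_def by (simp add: numeral_eq_Suc)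
  have SB: "S \<subseteq> V" "card S = 5" "finite S" if "S \<in> SB" for S
    using saturated_layer4[OF F(2)] that unfolding SB_def G_def by blast+
  have meet: "card (S \<inter> S') \<le> 1" if "S \<in> SB" "S' \<in> SB" "S \<noteq> S'" for S S'
    using saturated_layer4_meet that unfolding SB_def G_def by blast
  show ?thesis
  proof (cases "card SB \<le> 1")
    case True
    then show ?thesis using count unfolding G_def by linarith
  next
    case False
    then obtain S T where ST: "S \<in> SB" "T \<in> SB" "S \<noteq> T"
      using card_le_Suc0_iff_eq[of SB] card.infinite[of SB] by fastforce
    define W where "W = V - (S \<union> T)"
    define X where "X = {U \<in> G. \<not> U \<subseteq> S \<and> \<not> U \<subseteq> T}"
    have "card (S \<union> T) \<ge> 9" using card_Un_Int[of S T] meet[OF ST] SB[OF ST(1)] SB[OF ST(2)] by linarith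
    then have W: "card W \<le> 2" "finite W"
      using card_Diff_subset[of "S \<union> T" V] SB[OF ST(1)] SB[OF ST(2)] V unfolding W_def by auto
    have U_W: "W \<subseteq> U \<and> card W = 2" if U: "U \<in> X" for U
    proof -
      have UG: "U \<in> G" "\<not> U \<subseteq> S" "\<not> U \<subseteq> T" using U unfolding X_def by auto
      have small: "card (U \<inter> S) \<le> 1" "card (U \<inter> T) \<le> 1"
        using saturated_inside[of S G U] saturated_inside[of T G U] UG ST unfolding SB_def by auto
      have "U \<subseteq> V" "card U = 4" using UG(1) F(2) unfolding G_def by auto
      then have "U = (U \<inter> S) \<union> (U \<inter> T) \<union> (U \<inter> W)" unfolding W_def by blast
      then have "4 \<le> card (U \<inter> S) + card (U \<inter> T) + card (U \<inter> W)"
        using card_Un_le[of "(U \<inter> S) \<union> (U \<inter> T)" "U \<inter> W"] card_Un_le[of "U \<inter> S" "U \<inter> T"] \<open>card U = 4\<close>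
        by simp
      then have "2 \<le> card (U \<inter> W)" using small by linarith
      moreover have "card (U \<inter> W) \<le> card W" using W by (intro card_mono) auto
      ultimately have "card (U \<inter> W) = card W" "card W = 2" using W by linarith+
      then show ?thesis using card_subset_eq[of W "U \<inter> W"] W by auto
    qed
    have fin4: "finite A" if "A \<in> G" for A using compatible_finite[OF F(1)] that unfolding G_def by blast
    have "card X \<le> max 5 (card V - 3)"
    proof (rule card_four_sets_meeting_twice[OF V(1)])
      show "A \<subseteq> V \<and> card A = 4" if "A \<in> X" for A using that F(2) unfolding X_def G_def by auto
      show "2 < card (A \<inter> B)" if AB: "A \<in> X" "B \<in> X" for A B
      proof -
        have AB_G: "A \<in> G" "B \<in> G" using AB unfolding X_def by auto
        have "card W \<le> card (A \<inter> B)" using U_W AB fin4[OF AB_G(1)] by (intro card_mono) auto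
        then have "2 \<le> card (A \<inter> B)" using U_W[OF AB(1)] by simp
        then show ?thesis using compatible_near3[OF F(1), of A B] AB_G unfolding G_def by simp
      qed
    qed
    then have X: "card X \<le> 8" using V(2) by simp
    have inS: "card {U. U \<subseteq> S' \<and> card U = 4} = 5 \<and> finite {U. U \<subseteq> S' \<and> card U = 4}" if "S' \<in> SB" for S'
      using SB[OF that] by (simp add: n_subsets numeral_eq_Suc)
    have "finite X"
      using finite_subset[of X "Pow V"] V(1) F(2) unfolding X_def G_def by auto
    have "G \<subseteq> X \<union> {U. U \<subseteq> S \<and> card U = 4} \<union> {U. U \<subseteq> T \<and> card U = 4}"
      unfolding X_def G_def by blast
    then have "card G \<le> card (X \<union> {U. U \<subseteq> S \<and> card U = 4} \<union> {U. U \<subseteq> T \<and> card U = 4})"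
      using inS[OF ST(1)] inS[OF ST(2)] \<open>finite X\<close> by (intro card_mono) auto
    also have "\<dots> \<le> card X + 5 + 5"
      using card_Un_le[of "X \<union> {U. U \<subseteq> S \<and> card U = 4}" "{U. U \<subseteq> T \<and> card U = 4}"]
        card_Un_le[of X "{U. U \<subseteq> S \<and> card U = 4}"] inS[OF ST(1)] inS[OF ST(2)] by linarith
    finally show ?thesis using X unfolding G_def by linarith
  qed
qed

section \<open>The trace of a member on a cluster\<close>

text \<open>
  A set with two points in the core shares two points with every set of the cluster, so it is near
  all of them. If at least two of its points were outside \<open>D\<close>, it would contain, besides two points
  of \<open>D\<close>, the extra point of each of the at least four sets of the cluster, and it has at most five
  points.
\<close>

lemma trace_on_core:
  assumes F: "compatible_family F" and D: "finite D" "card D = 4"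
    and C: "C \<subseteq> {A \<in> layer 5 F. D \<subseteq> A}" "4 \<le> card C"
    and X: "X \<in> F" "\<not> (card X = 5 \<and> D \<subseteq> X)"
  shows "card (X \<inter> D) \<le> 1 \<or> card X = 4 \<and> 3 \<le> card (X \<inter> D)"
proof (rule ccontr)
  assume neg: "\<not> ?thesis"
  have finX: "finite X" using compatible_finite[OF F X(1)] .
  have two: "2 \<le> card (X \<inter> D)" using neg by simp
  have far: "Suc (card (X \<inter> D)) < card X"
  proof (rule ccontr)
    assume "\<not> ?thesis"
    then have ge: "card X \<le> Suc (card (X \<inter> D))" by simp
    show False
    proof (cases "card X = 5")
      case True
      then have "card D \<le> card (X \<inter> D)" using ge D by simp
      then have "X \<inter> D = D" using D by (intro card_seteq) auto
      then show False using True X(2) by blast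
    next
      case False
      then show False using compatible_card[OF F X(1)] ge neg by auto
    qed
  qed
  have "A \<subseteq> X \<union> D" if A: "A \<in> C" for A
  proof -
    have AF: "A \<in> F" "card A = 5" "D \<subseteq> A" using A C by auto
    have finA: "finite A" using compatible_finite[OF F AF(1)] .
    have "card (X \<inter> D) \<le> card (X \<inter> A)" using AF finX by (intro card_mono) auto
    then have "card X \<le> Suc (card (X \<inter> A))"
      using compatible_near[OF F X(1) AF(1)] two AF(2) compatible_card[OF F X(1)] by auto
    then have "X \<inter> D \<noteq> X \<inter> A" using far by auto
    then obtain x where x: "x \<in> X" "x \<in> A" "x \<notin> D" using AF(3) by blast
    have "card (A - D) = 1" using AF(2,3) D by (simp add: card_Diff_subset)
    then obtain a where a: "A - D = {a}" by (rule card_1_singletonE)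
    moreover have "x \<in> A - D" using x by blast
    ultimately have "A - D \<subseteq> X" using x(1) by simp
    then show ?thesis by blast
  qed
  then have "card C \<le> card (X \<union> D - D)"
    using C D finX by (intro card_family_over_core[of _ D 4]) auto
  also have "X \<union> D - D = X - X \<inter> D" by blast
  also have "card (X - X \<inter> D) = card X - card (X \<inter> D)" using finX by (simp add: card_Diff_subset)
  finally show False using C(2) two compatible_card[OF F X(1)] by auto
qed

text \<open>
  Outside the core \<open>A\<close> has only one point, so \<open>X\<close> and \<open>A\<close> share at most two points, while near sets
  share three.
\<close>

lemma far_from_core:
  assumes F: "compatible_family F" and D: "finite D" "card D = 4"
    and X: "X \<in> F" "card (X \<inter> D) \<le> 1" and A: "A \<in> layer 5 F" "D \<subseteq> A"
  shows "card (X \<inter> A) \<le> 1"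
proof (rule ccontr)
  assume "\<not> ?thesis"
  then have "3 \<le> card (X \<inter> A)" using compatible_near3[OF F X(1), of A] A by simp
  moreover have "card (X \<inter> A) \<le> card (X \<inter> D) + card (A - D)"
  proof -
    have "X \<inter> A \<subseteq> (X \<inter> D) \<union> (A - D)" by blast
    then have "card (X \<inter> A) \<le> card ((X \<inter> D) \<union> (A - D))"
      using D A compatible_finite[OF F, of A] by (intro card_mono) auto
    then show ?thesis using card_Un_le[of "X \<inter> D" "A - D"] by linarith
  qed
  moreover have "card (A - D) = 1" using A D by (simp add: card_Diff_subset)
  ultimately show False using X(2) by linarith
qed

text \<open>
  The sets of the cluster are the ball without one point \<open>y\<close>, for at least four different \<open>y\<close>.
  Suppose \<open>X\<close> has at least two points in the ball and one outside. If the trace has exactly two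
  points, every such \<open>y\<close> is one of them, as otherwise \<open>X\<close> would meet a set of the cluster in exactly
  two points. If the trace is larger, no \<open>y\<close> is in the trace, since \<open>X\<close> would then have two points
  outside a set that it is near; this leaves at most three \<open>y\<close>.
\<close>

lemma trace_on_ball:
  assumes F: "compatible_family F" and K: "finite K" "card K = 6"
    and C: "C \<subseteq> {A \<in> layer 5 F. A \<subseteq> K}" "4 \<le> card C"
    and X: "X \<in> F" "\<not> (card X = 5 \<and> X \<subseteq> K)"
  shows "card (X \<inter> K) \<le> 1 \<or> card X = 4 \<and> X \<subseteq> K"
proof (rule ccontr)
  assume neg: "\<not> ?thesis"
  have finX: "finite X" using compatible_finite[OF F X(1)] .
  define Z where "Z = X \<inter> K"
  have Z: "2 \<le> card Z" "Z \<subseteq> K" "finite Z" using neg K unfolding Z_def by auto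
  have notK: "\<not> X \<subseteq> K" using neg X compatible_card[OF F X(1)] by blast
  then have "Z \<subset> X" unfolding Z_def by blast
  then have Z_lt: "card Z < card X" using finX by (rule psubset_card_mono[rotated])
  have C_form: "\<exists>y\<in>K. A = K - {y}" if A: "A \<in> C" for A
  proof -
    have "A \<subseteq> K" "card A = 5" using A C by auto
    then have "card (K - A) = 1" using K finite_subset[of A K] by (simp add: card_Diff_subset)
    then obtain y where "K - A = {y}" by (auto simp: card_1_singleton_iff)
    then show ?thesis using \<open>A \<subseteq> K\<close> by blast
  qed
  have near: "card X \<le> Suc (card (Z \<inter> A))" if A: "A \<in> C" "2 \<le> card (Z \<inter> A)" for A
  proof -
    have AF: "A \<in> F" "card A = 5" "A \<subseteq> K" using A C by auto
    have "Z \<inter> A = X \<inter> A" using AF unfolding Z_def by blast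
    then show ?thesis
      using compatible_near[OF F X(1) AF(1)] A(2) AF(2) compatible_card[OF F X(1)] by auto
  qed
  show False
  proof (cases "card Z = 2")
    case True
    have "C \<subseteq> (\<lambda>y. K - {y}) ` Z"
    proof
      fix A assume A: "A \<in> C"
      then obtain y where y: "y \<in> K" "A = K - {y}" using C_form by blast
      have "y \<in> Z"
      proof (rule ccontr)
        assume "y \<notin> Z"
        then have "Z \<inter> A = Z" using y Z(2) by blast
        then show False using near[OF A] True compatible_card[OF F X(1)] by auto
      qed
      then show "A \<in> (\<lambda>y. K - {y}) ` Z" using y by blast
    qed
    then have "card C \<le> card Z" using surj_card_le[OF Z(3)] by blast
    then show False using True C(2) by simp
  next
    case False
    have "C \<subseteq> (\<lambda>y. K - {y}) ` (K - Z)"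
    proof
      fix A assume A: "A \<in> C"
      then obtain y where y: "y \<in> K" "A = K - {y}" using C_form by blast
      have "y \<notin> Z"
      proof
        assume "y \<in> Z"
        moreover have "Z \<inter> A = Z - {y}" using y Z(2) by blast
        ultimately have eq: "card (Z \<inter> A) = card Z - 1" using Z(3) by simp
        then have "2 \<le> card (Z \<inter> A)" using False Z(1) by linarith
        then show False using near[OF A] eq Z(1) Z_lt by linarith
      qed
      then show "A \<in> (\<lambda>y. K - {y}) ` (K - Z)" using y by blast
    qed
    then have "card C \<le> card (K - Z)" using surj_card_le[of "K - Z"] K(1) by blast
    then show False using False Z K C(2) by (simp add: card_Diff_subset)
  qed
qed

section \<open>Members on seven points\<close>

lemma four_sets_in_ball:
  assumes F: "compatible_family F" and K: "finite K" "card K = 6"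
  shows "card {A \<in> layer 4 F. A \<subseteq> K} \<le> 5"
proof -
  have "card {A \<in> layer 4 F. A \<subseteq> K} \<le> max 5 (card K - 3)"
  proof (rule card_four_sets_meeting_twice[OF K(1)])
    fix A B assume AB: "A \<in> {A \<in> layer 4 F. A \<subseteq> K}" "B \<in> {A \<in> layer 4 F. A \<subseteq> K}"
    then have "A \<inter> K = A" "B \<inter> K = B" by auto
    then have "card A + card B \<le> card K + card (A \<inter> B)"
      using card_Int_ge[of K A B] AB K compatible_finite[OF F, of A] by simp
    then have "2 \<le> card (A \<inter> B)" using AB K by simp
    then show "2 < card (A \<inter> B)" using compatible_near3[OF F, of A B] AB by simp
  qed auto
  then show ?thesis using K by simp
qed

lemma five_sets_in_ball:
  assumes "finite K" "card K = 6"
  shows "card {A \<in> layer 5 F. A \<subseteq> K} \<le> 6"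
  using card_family_in_ball[of K 4 "{A \<in> layer 5 F. A \<subseteq> K}"] assms by simp

text \<open>
  On seven points two five-element sets meet in three points, so they form one cluster. If it has at
  most three sets, there are at most \<open>3 + 8\<close> members. Otherwise it has no core, as a core leaves
  only three further points, so it lies in a ball. Four points out of seven meet the ball in at
  least three, hence all members lie in the ball.
\<close>

lemma compatible_seven_points:
  assumes F: "compatible_family F" "F \<subseteq> Pow E" and E: "finite E" "card E = 7"
  shows "card F \<le> 11"
proof -
  have finF: "finite F" using F(2) E(1) by (simp add: finite_subset)
  have split: "card F = card (layer 4 F) + card (layer 5 F)" using card_split_layers[OF F(1) finF] .
  show ?thesis
  proof (cases "card (layer 5 F) \<le> 3")
    case True
    then show ?thesis using split layer4_seven_points[OF F E] by linarith
  next
    case False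
    have meet: "card (A \<inter> B) = 4" if "A \<in> layer 5 F" "B \<in> layer 5 F" "A \<noteq> B" for A B
    proof -
      have "A \<inter> E = A" "B \<inter> E = B" using that F(2) by auto
      then have "2 \<le> card (A \<inter> B)"
        using card_Int_ge[of E A B] that E compatible_finite[OF F(1), of A] by simp
      then show ?thesis using near_layer5_eq[OF F(1) that] by simp
    qed
    have "layer 5 F \<noteq> {}" using False by force
    then consider (core) D where "finite D" "card D = 4" "\<And>A. A \<in> layer 5 F \<Longrightarrow> D \<subseteq> A"
      | (ball) K where "finite K" "card K = 4 + 2" "\<And>A. A \<in> layer 5 F \<Longrightarrow> A \<subseteq> K"
      using adjacent_family_cases[of "layer 5 F" 4] meet by auto
    then show ?thesis
    proof cases
      case (core D)
      obtain A where "A \<in> layer 5 F" using \<open>layer 5 F \<noteq> {}\<close> by blast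
      then have "D \<subseteq> E" using core(3)[of A] F(2) by auto
      then have "card (E - D) = 3" using core E by (simp add: card_Diff_subset)
      moreover have "card (layer 5 F) \<le> card (E - D)"
        using core E F(2) by (intro card_family_over_core[of _ _ 4]) auto
      ultimately show ?thesis using False by simp
    next
      case (ball K)
      have K: "finite K" "card K = 6" using ball by auto
      have L5: "layer 5 F \<subseteq> {A \<in> layer 5 F. A \<subseteq> K}" "4 \<le> card (layer 5 F)"
        using ball(3) False by auto
      have "K \<subseteq> E"
      proof -
        obtain A B where AB: "A \<in> layer 5 F" "B \<in> layer 5 F" "A \<noteq> B"
          using False card_le_Suc0_iff_eq[of "layer 5 F"] finF by fastforce
        have finAB: "finite A" "finite B" using AB compatible_finite[OF F(1)] by auto
        have "card (A \<union> B) = 6" using card_Un_Int[OF finAB] meet[OF AB] AB by simp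
        moreover have "A \<union> B \<subseteq> K" using ball(3) AB by blast
        ultimately have "A \<union> B = K" using K by (intro card_subset_eq) auto
        then show ?thesis using AB F(2) by auto
      qed
      have "X \<subseteq> K" if X: "X \<in> layer 4 F" for X
      proof -
        have "X \<inter> E = X" "K \<inter> E = K" using X F(2) \<open>K \<subseteq> E\<close> by auto
        then have "3 \<le> card (X \<inter> K)"
          using card_Int_ge[of E X K] X E K compatible_finite[OF F(1), of X] by simp
        then show ?thesis using trace_on_ball[OF F(1) K L5, of X] X by auto
      qed
      then have "layer 4 F = {A \<in> layer 4 F. A \<subseteq> K}" by blast
      moreover have "layer 5 F = {A \<in> layer 5 F. A \<subseteq> K}" using L5(1) by blast
      ultimately show ?thesis
        using split four_sets_in_ball[OF F(1) K] five_sets_in_ball[OF K, of F] by simp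
    qed
  qed
qed

section \<open>The maximum size on eleven points\<close>

text \<open>
  Besides the three kinds of members that add up to \<open>7 + 8 + 11\<close>, a member of \<open>T\<close> may meet \<open>D\<close> in
  one point. It then avoids all other points of the cluster, which leaves it enough points only if
  the cluster has exactly four sets; it consists of a point of \<open>D\<close> and the three points \<open>W\<close> outside
  the cluster. Now the first summand is 4 instead of 7, which pays for three such sets. If all four
  occur, the sets with three points in \<open>D\<close> must avoid \<open>W\<close>, which reduces the 8 to 5.
\<close>

lemma core_cluster_bound:
  assumes F: "compatible_family F" "F \<subseteq> Pow V" and V: "finite V" "card V = 11"
    and D: "finite D" "card D = 4"
    and C: "C \<subseteq> {A \<in> layer 5 F. D \<subseteq> A}" "4 \<le> card C"
  shows "card F \<le> 26"
proof -
  define C' where "C' = {A \<in> layer 5 F. D \<subseteq> A}"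
  define N where "N = {X \<in> layer 4 F. 3 \<le> card (X \<inter> D)}"
  define E where "E = {X \<in> F. X \<subseteq> V - D}"
  define T where "T = {X \<in> F. \<not> (card X = 5 \<and> D \<subseteq> X) \<and> card (X \<inter> D) = 1}"
  define W where "W = V - \<Union>C'"
  have finF: "finite F" using F(2) V(1) by (simp add: finite_subset)
  have fin: "finite X" if "X \<in> F" for X using compatible_finite[OF F(1) that] .
  have C'4: "4 \<le> card C'"
    using C card_mono[of C' C] finF unfolding C'_def by auto
  have "F \<subseteq> C' \<union> N \<union> E \<union> T"
  proof
    fix X assume X: "X \<in> F"
    show "X \<in> C' \<union> N \<union> E \<union> T"
    proof (cases "card X = 5 \<and> D \<subseteq> X")
      case True
      then show ?thesis using X unfolding C'_def by auto
    next
      case False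
      consider "card (X \<inter> D) = 0" | "card (X \<inter> D) = 1" | "card X = 4" "3 \<le> card (X \<inter> D)"
        using trace_on_core[OF F(1) D C X False] by linarith
      then show ?thesis
      proof cases
        case 1
        then have "X \<inter> D = {}" using D(1) by simp
        then show ?thesis using X F(2) unfolding E_def by blast
      qed (use X False in \<open>auto simp: T_def N_def\<close>)
    qed
  qed
  then have "card F \<le> card (C' \<union> N \<union> E \<union> T)"
    using finF unfolding C'_def N_def E_def T_def by (intro card_mono) auto
  then have sum: "card F \<le> card C' + card N + card E + card T"
    using card_Un_le[of "C' \<union> N \<union> E" T] card_Un_le[of "C' \<union> N" E] card_Un_le[of C' N] by linarith
  \<comment> \<open>\<open>\<Union>C'\<close> consists of the core and one extra point for each set of the cluster.\<close>
  obtain A0 where A0: "A0 \<in> C'" using C'4 by fastforce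
  then have "D \<subseteq> V" "D \<subseteq> \<Union>C'" using F(2) unfolding C'_def by auto
  have VD: "card (V - D) = 7" using \<open>D \<subseteq> V\<close> D V by (simp add: card_Diff_subset)
  have C'V: "\<Union>C' \<subseteq> V" using F(2) unfolding C'_def by auto
  then have finC': "finite (\<Union>C')" using V(1) finite_subset by blast
  have "card C' \<le> card (V - D)"
    using D V F(2) by (intro card_family_over_core[of _ _ 4]) (auto simp: C'_def)
  then have C'7: "card C' \<le> 7" using VD by simp
  have E11: "card E \<le> 11"
    using compatible_seven_points[OF compatible_family_subset[OF F(1), of E], of "V - D"] V VD
    unfolding E_def by auto
  have N_bound: "card N \<le> max 5 (card U - 3)" if U: "finite U" "\<And>X. X \<in> N \<Longrightarrow> X \<subseteq> U" for U
  proof (rule card_four_sets_meeting_twice[OF U(1)])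
    show "A \<subseteq> U \<and> card A = 4" if "A \<in> N" for A using U(2) that unfolding N_def by auto
    fix A B assume AB: "A \<in> N" "B \<in> N"
    then have "3 \<le> card (A \<inter> D)" "3 \<le> card (B \<inter> D)" unfolding N_def by auto
    then have "2 \<le> card (A \<inter> B)"
      using card_Int_ge[of D A B] D fin[of A] AB unfolding N_def by auto
    then show "2 < card (A \<inter> B)" using compatible_near3[OF F(1), of A B] AB unfolding N_def by auto
  qed
  have N8: "card N \<le> 8" using N_bound[of V] V F(2) unfolding N_def by auto
  have "card C' \<le> card (\<Union>C' - D)"
    using D finC' by (intro card_family_over_core[of _ _ 4]) (auto simp: C'_def)
  then have "4 + card C' \<le> card (\<Union>C')"
    using D \<open>D \<subseteq> \<Union>C'\<close> finC' card_mono[of "\<Union>C'" D] by (simp add: card_Diff_subset)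
  then have W: "card W + card C' \<le> 7"
    using C'V finC' V card_mono[of V "\<Union>C'"] unfolding W_def by (simp add: card_Diff_subset)
  have finW: "finite W" using V unfolding W_def by simp
  have T_form: "card W = 3 \<and> (\<exists>d\<in>D. X = insert d W)" if X: "X \<in> T" for X
  proof -
    have XF: "X \<in> F" "card (X \<inter> D) = 1" "X \<subseteq> V" using X F(2) unfolding T_def by auto
    obtain d where d: "X \<inter> D = {d}" using XF(2) by (auto simp: card_1_singleton_iff)
    have "X \<inter> A = {d}" if A: "A \<in> C'" for A
    proof -
      have AF: "A \<in> layer 5 F" "D \<subseteq> A" using A unfolding C'_def by auto
      have "card (X \<inter> A) \<le> 1" using far_from_core[OF F(1) D XF(1) _ AF] XF(2) by simp
      moreover have "{d} \<subseteq> X \<inter> A" using d AF(2) by blast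
      ultimately show ?thesis using card_seteq[of "X \<inter> A" "{d}"] fin[OF XF(1)] by simp
    qed
    then have sub: "X - {d} \<subseteq> W" using XF(3) unfolding W_def by blast
    have "card (X - {d}) = card X - 1" using d fin[OF XF(1)] by (intro card_Diff_singleton) auto
    then have "3 \<le> card (X - {d})" using compatible_card[OF F(1) XF(1)] by auto
    moreover have "card W \<le> 3" using W C'4 by linarith
    ultimately have "X - {d} = W" "card W = 3"
      using card_seteq[OF finW sub] card_mono[OF finW sub] by auto
    then show ?thesis using d by blast
  qed
  show ?thesis
  proof (cases "T = {}")
    case True
    then show ?thesis using sum C'7 E11 N8 by simp
  next
    case False
    then have W3: "card W = 3" using T_form by blast
    then have C'_eq: "card C' \<le> 4" using W by linarith
    have T_sub: "T \<subseteq> (\<lambda>d. insert d W) ` D" using T_form by blast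
    then have T4: "card T \<le> 4" using surj_card_le[OF D(1)] D(2) by metis
    show ?thesis
    proof (cases "card T = 4")
      case False
      then show ?thesis using sum C'_eq E11 N8 T4 by linarith
    next
      case True
      have "card ((\<lambda>d. insert d W) ` D) \<le> card T" using True card_image_le[OF D(1)] D(2) by metis
      then have T_eq: "T = (\<lambda>d. insert d W) ` D" using T_sub D(1) by (intro card_seteq) auto
      have "X \<subseteq> V - W" if X: "X \<in> N" for X
      proof (rule ccontr)
        have XF: "X \<in> F" "card X = 4" "3 \<le> card (X \<inter> D)" "X \<subseteq> V"
          using X F(2) unfolding N_def by auto
        assume "\<not> ?thesis"
        then obtain w where w: "w \<in> X" "w \<in> W" using XF(4) by blast
        then have "w \<notin> D" using \<open>D \<subseteq> \<Union>C'\<close> unfolding W_def by blast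
        have "insert w (X \<inter> D) = X"
          using XF w \<open>w \<notin> D\<close> fin[OF XF(1)] by (intro card_seteq) auto
        moreover obtain t where t: "t \<in> X \<inter> D"
          using XF(3) card.empty by (metis ex_in_conv not_numeral_le_zero)
        moreover have "W \<inter> D = {}" using \<open>D \<subseteq> \<Union>C'\<close> unfolding W_def by blast
        ultimately have "X \<inter> insert t W = {t, w}" using w by blast
        moreover have "t \<noteq> w" using t \<open>w \<notin> D\<close> by blast
        moreover have "insert t W \<in> F" using t T_eq unfolding T_def by blast
        ultimately show False using compatible_near3[OF F(1) XF(1), of "insert t W"] by simp
      qed
      then have "card N \<le> max 5 (card (V - W) - 3)" using N_bound[of "V - W"] V by blast
      moreover have "card (V - W) = 8"
        using V W3 finW by (subst card_Diff_subset) (auto simp: W_def)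
      ultimately show ?thesis using sum C'_eq E11 T4 by simp
    qed
  qed
qed

text \<open>
  Two four-element sets near the same large cluster both have three points in its core, or both lie
  in its ball, so they share two points.
\<close>

lemma four_sets_near_cluster:
  assumes F: "compatible_family F"
    and H: "H \<subseteq> layer 5 F" "4 \<le> card H"
    and meet: "\<And>A B. A \<in> H \<Longrightarrow> B \<in> H \<Longrightarrow> A \<noteq> B \<Longrightarrow> card (A \<inter> B) = 4"
    and U: "U \<in> layer 4 F" "A \<in> H" "2 \<le> card (U \<inter> A)"
    and U': "U' \<in> layer 4 F" "A' \<in> H" "2 \<le> card (U' \<inter> A')"
  shows "2 < card (U \<inter> U')"
proof -
  have fin: "finite U" using compatible_finite[OF F] U(1) by blast
  have "2 \<le> card (U \<inter> U')"
  proof -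
    have "H \<noteq> {}" using U(2) by blast
    have H5: "card B = Suc 4" if "B \<in> H" for B using H(1) that by auto
    consider (core) D where "finite D" "card D = 4" "\<And>B. B \<in> H \<Longrightarrow> D \<subseteq> B"
      | (ball) K where "finite K" "card K = 4 + 2" "\<And>B. B \<in> H \<Longrightarrow> B \<subseteq> K"
      using adjacent_family_cases[of H 4, OF H5 meet \<open>H \<noteq> {}\<close>] by blast
    then show ?thesis
    proof cases
      case (core D)
      have HD: "H \<subseteq> {A \<in> layer 5 F. D \<subseteq> A}" using core(3) H(1) by blast
      have "3 \<le> card (X \<inter> D)" if X: "X \<in> layer 4 F" "B \<in> H" "2 \<le> card (X \<inter> B)" for X B
        using trace_on_core[OF F core(1,2) HD H(2), of X] far_from_core[OF F core(1,2), of X B] X HD by auto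
      from this[OF U] this[OF U'] show ?thesis
        using card_Int_ge[OF core(1) fin, of U'] core(2) by linarith
    next
      case (ball K)
      have HK: "H \<subseteq> {A \<in> layer 5 F. A \<subseteq> K}" using ball(3) H(1) by blast
      have K: "finite K" "card K = 6" using ball(1,2) by auto
      have "X \<inter> K = X" if X: "X \<in> layer 4 F" "B \<in> H" "2 \<le> card (X \<inter> B)" for X B
      proof -
        have "card (X \<inter> B) \<le> card (X \<inter> K)" using K X(2) HK by (intro card_mono) auto
        then show ?thesis using trace_on_ball[OF F K HK H(2), of X] X by auto
      qed
      from this[OF U] this[OF U'] show ?thesis
        using card_Int_ge[OF K(1) fin, of U'] K(2) U(1) U'(1) by simp
    qed
  qed
  then show ?thesis using compatible_near3[OF F, of U U'] U(1) U'(1) by auto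
qed

text \<open>
  The class of \<open>U\<close> lies in a five-element set or has a common triple. A triple inside \<open>Q\<close> meets \<open>U'\<close>
  in a point; as the sets of the class are far from \<open>U'\<close>, they avoid its other three points, and
  five points remain. A triple not inside \<open>Q\<close> forces the fourth point of each set into \<open>Q\<close>.
\<close>

lemma near_class_le_5:
  assumes F: "compatible_family F" and R: "R \<subseteq> layer 4 F" "\<And>X. X \<in> R \<Longrightarrow> X \<subseteq> V"
    and V: "finite V" "card V = 11" and Q: "finite Q" "card Q = 5"
    and trace: "\<And>X. X \<in> R \<Longrightarrow> 3 \<le> card (X \<inter> Q)"
    and U: "U \<in> R" "U' \<in> R" "card (U \<inter> U') \<le> 1"
  shows "card {X \<in> R. 2 \<le> card (X \<inter> U)} \<le> 5"
proof -
  define Y where "Y = {X \<in> R. 2 \<le> card (X \<inter> U)}"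
  have Y: "X \<in> layer 4 F" "X \<subseteq> V" "3 \<le> card (X \<inter> Q)" "2 \<le> card (X \<inter> U)" "card X = 4" if "X \<in> Y" for X
    using that R trace unfolding Y_def by auto
  have U4: "U \<in> layer 4 F" "U' \<in> layer 4 F" using U R by auto
  have fin: "finite X" if "X \<in> layer 4 F" for X using compatible_finite[OF F] that by blast
  have "U \<in> Y" using U U4 unfolding Y_def by simp
  then have "Y \<noteq> {}" by blast
  have Y4: "card X = Suc 3" if "X \<in> Y" for X using Y(5)[OF that] by simp
  have "card (A \<inter> B) = 3" if AB: "A \<in> Y" "B \<in> Y" "A \<noteq> B" for A B
    using near_layer4_trans[OF F Y(1)[OF AB(1)] U4(1) Y(1)[OF AB(2)]] Y(4,5)[OF AB(1)] Y(4,5)[OF AB(2)]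
      card_Int_lt[OF fin[OF Y(1)[OF AB(1)]] fin[OF Y(1)[OF AB(2)]]] AB(3)
    by (simp add: Int_commute)
  then consider (core) T where "finite T" "card T = 3" "\<And>A. A \<in> Y \<Longrightarrow> T \<subseteq> A"
    | (ball) S where "finite S" "card S = 3 + 2" "\<And>A. A \<in> Y \<Longrightarrow> A \<subseteq> S"
    using adjacent_family_cases[of Y 3, OF Y4 _ \<open>Y \<noteq> {}\<close>] by blast
  then have "card Y \<le> 5"
  proof cases
    case (core T)
    show ?thesis
    proof (cases "T \<subseteq> Q")
      case True
      then have "card (T \<inter> Q) = 3" using core(2) by (simp add: Int_absorb2)
      then have "1 \<le> card (T \<inter> U')"
        using card_Int_ge[OF Q(1) core(1), of U'] trace[OF U(2)] Q(2) by linarith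
      then have "T \<inter> U' \<noteq> {}" by force
      then obtain t where t: "t \<in> T" "t \<in> U'" by blast
      define V' where "V' = V - (U' - {t})"
      have "card (A \<inter> U') \<le> 1" if A: "A \<in> Y" for A
      proof (rule ccontr)
        assume "\<not> ?thesis"
        then have "2 < card (U \<inter> U')"
          using near_layer4_trans[OF F U4(1) Y(1)[OF A] U4(2)] Y(4)[OF A] by (simp add: Int_commute)
        then show False using U(3) by simp
      qed
      then have sub: "A \<subseteq> V'" if A: "A \<in> Y" for A
        using t core(3)[OF A] Y(2)[OF A] A card_le_Suc0_iff_eq[of "A \<inter> U'"] fin[OF Y(1)[OF A]]
        unfolding V'_def by fastforce
      have "card (U' - {t}) = 3" using t(2) U4(2) fin[OF U4(2)] by simp
      then have V': "card V' = 8" "finite V'"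
        using V R(2)[OF U(2)] fin[OF U4(2)] card_Diff_subset[of "U' - {t}" V]
        unfolding V'_def by auto
      have "T \<subseteq> V'" using core(3) sub \<open>U \<in> Y\<close> by blast
      then have "card (V' - T) = 5" using V' core by (simp add: card_Diff_subset)
      moreover have "card Y \<le> card (V' - T)"
        using V' core sub Y(5) by (intro card_family_over_core[of _ _ 3]) auto
      ultimately show ?thesis by simp
    next
      case False
      have "A \<subseteq> T \<union> Q" if A: "A \<in> Y" for A
      proof -
        have finA: "finite A" using fin[OF Y(1)[OF A]] .
        have "A \<inter> Q \<noteq> A \<inter> (T \<union> Q)" using False core(3)[OF A] by blast
        then have "A \<inter> Q \<subset> A \<inter> (T \<union> Q)" by blast
        then have "card (A \<inter> Q) < card (A \<inter> (T \<union> Q))" using finA by (intro psubset_card_mono) auto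
        then have "card A \<le> card (A \<inter> (T \<union> Q))" using Y(3,5)[OF A] by simp
        then have "A \<inter> (T \<union> Q) = A" using finA by (intro card_seteq) auto
        then show ?thesis by blast
      qed
      then have "card Y \<le> card (T \<union> Q - T)"
        using core Q Y(5) by (intro card_family_over_core[of _ _ 3]) auto
      also have "\<dots> \<le> card Q" using Q by (intro card_mono) auto
      finally show ?thesis using Q by simp
    qed
  next
    case (ball S)
    then show ?thesis using card_family_in_ball[of S 3 Y] Y(5) by simp
  qed
  then show ?thesis unfolding Y_def .
qed

text \<open>
  If two of the sets are far, their traces already cover \<open>Q\<close>, so every set is near one of these two;
  otherwise there is one class with at most \<open>11 - 3\<close> sets.
\<close>

lemma large_traces_le_10:
  assumes F: "compatible_family F" and R: "R \<subseteq> layer 4 F" "\<And>X. X \<in> R \<Longrightarrow> X \<subseteq> V"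
    and V: "finite V" "card V = 11" and Q: "finite Q" "card Q = 5"
    and trace: "\<And>X. X \<in> R \<Longrightarrow> 3 \<le> card (X \<inter> Q)"
  shows "card R \<le> 10"
proof (cases "\<forall>U\<in>R. \<forall>U'\<in>R. 2 < card (U \<inter> U')")
  case True
  then have "card R \<le> max 5 (card V - 3)"
    using R V by (intro card_four_sets_meeting_twice) auto
  then show ?thesis using V by simp
next
  case False
  then obtain U U' where U: "U \<in> R" "U' \<in> R" and "\<not> 2 < card (U \<inter> U')" by blast
  then have far: "card (U \<inter> U') \<le> 1"
    using compatible_near3[OF F, of U U'] R(1) by fastforce
  have fin: "finite X" if "X \<in> R" for X using compatible_finite[OF F, of X] R(1) that by auto
  have finR: "finite R" using finite_subset[of R "Pow V"] R(2) V(1) by blast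
  have cover: "Q \<subseteq> U \<union> U'"
  proof -
    have "card ((U \<inter> Q) \<inter> (U' \<inter> Q)) \<le> card (U \<inter> U')" using fin[OF U(1)] by (intro card_mono) auto
    then have "card Q \<le> card ((U \<inter> Q) \<union> (U' \<inter> Q))"
      using card_Un_Int[of "U \<inter> Q" "U' \<inter> Q"] trace[OF U(1)] trace[OF U(2)] far Q by simp
    then have "(U \<inter> Q) \<union> (U' \<inter> Q) = Q" using Q(1) by (intro card_seteq) auto
    then show ?thesis by blast
  qed
  have "R \<subseteq> {X \<in> R. 2 \<le> card (X \<inter> U)} \<union> {X \<in> R. 2 \<le> card (X \<inter> U')}"
  proof
    fix X assume X: "X \<in> R"
    have "X \<inter> Q \<subseteq> (X \<inter> U) \<union> (X \<inter> U')" using cover by blast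
    then have "card (X \<inter> Q) \<le> card ((X \<inter> U) \<union> (X \<inter> U'))" using fin[OF X] by (intro card_mono) auto
    then have "3 \<le> card (X \<inter> U) + card (X \<inter> U')"
      using trace[OF X] card_Un_le[of "X \<inter> U" "X \<inter> U'"] by linarith
    then show "X \<in> {X \<in> R. 2 \<le> card (X \<inter> U)} \<union> {X \<in> R. 2 \<le> card (X \<inter> U')}" using X by auto
  qed
  then have "card R \<le> card ({X \<in> R. 2 \<le> card (X \<inter> U)} \<union> {X \<in> R. 2 \<le> card (X \<inter> U')})"
    using finR by (intro card_mono) auto
  also have "\<dots> \<le> card {X \<in> R. 2 \<le> card (X \<inter> U)} + card {X \<in> R. 2 \<le> card (X \<inter> U')}"
    by (rule card_Un_le)
  also have "\<dots> \<le> 5 + 5"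
    using near_class_le_5[OF F R V Q trace U far] near_class_le_5[OF F R V Q trace U(2,1)] far
    by (intro add_mono) (auto simp: Int_commute)
  finally show ?thesis by simp
qed

text \<open>
  The members \<open>H\<close> and \<open>R\<close> not contained in \<open>K\<close> live almost completely on the five points \<open>Q\<close>
  outside, so the sets in \<open>H\<close> form one cluster, of size at most 7. If it has at least four sets, \<open>R\<close>
  is near to it and has at most 8 sets; otherwise \<open>R\<close> has at most 10.
\<close>

lemma ball_cluster_bound:
  assumes F: "compatible_family F" "F \<subseteq> Pow V" and V: "finite V" "card V = 11"
    and K: "finite K" "card K = 6" "K \<subseteq> V"
    and C: "C \<subseteq> {A \<in> layer 5 F. A \<subseteq> K}" "4 \<le> card C"
  shows "card F \<le> 26"
proof -
  define Q where "Q = V - K"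
  define H where "H = {X \<in> layer 5 F. card (X \<inter> K) \<le> 1}"
  define R where "R = {X \<in> layer 4 F. card (X \<inter> K) \<le> 1}"
  have finF: "finite F" using F(2) V(1) by (simp add: finite_subset)
  have fin: "finite X" if "X \<in> F" for X using compatible_finite[OF F(1) that] .
  have Q: "finite Q" "card Q = 5" using V K unfolding Q_def by (auto simp: card_Diff_subset)
  have "F \<subseteq> {A \<in> layer 5 F. A \<subseteq> K} \<union> {A \<in> layer 4 F. A \<subseteq> K} \<union> H \<union> R"
    using trace_on_ball[OF F(1) K(1,2) C] compatible_card[OF F(1)] unfolding H_def R_def by blast
  then have "card F \<le> card ({A \<in> layer 5 F. A \<subseteq> K} \<union> {A \<in> layer 4 F. A \<subseteq> K} \<union> H \<union> R)"
    using finF unfolding H_def R_def by (intro card_mono) auto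
  also have "\<dots> \<le> card {A \<in> layer 5 F. A \<subseteq> K} + card {A \<in> layer 4 F. A \<subseteq> K} + card H + card R"
    using card_Un_le[of "{A \<in> layer 5 F. A \<subseteq> K} \<union> {A \<in> layer 4 F. A \<subseteq> K} \<union> H" R]
      card_Un_le[of "{A \<in> layer 5 F. A \<subseteq> K} \<union> {A \<in> layer 4 F. A \<subseteq> K}" H]
      card_Un_le[of "{A \<in> layer 5 F. A \<subseteq> K}" "{A \<in> layer 4 F. A \<subseteq> K}"] by linarith
  also have "\<dots> \<le> 11 + card H + card R"
    using five_sets_in_ball[OF K(1,2), of F] four_sets_in_ball[OF F(1) K(1,2)] by linarith
  finally have sum: "card F \<le> 11 + card H + card R" .
  have trace: "card X \<le> Suc (card (X \<inter> Q))" if X: "X \<in> F" "card (X \<inter> K) \<le> 1" for X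
  proof -
    have "X = (X \<inter> K) \<union> (X \<inter> Q)" using X F(2) unfolding Q_def by blast
    then have "card X \<le> card (X \<inter> K) + card (X \<inter> Q)" using card_Un_le[of "X \<inter> K" "X \<inter> Q"] by simp
    then show ?thesis using X(2) by linarith
  qed
  have HQ: "4 \<le> card (X \<inter> Q)" if "X \<in> H" for X using trace[of X] that unfolding H_def by auto
  have RQ: "3 \<le> card (X \<inter> Q)" if "X \<in> R" for X using trace[of X] that unfolding R_def by auto
  have H_sub: "H \<subseteq> layer 5 F" and R_sub: "R \<subseteq> layer 4 F" unfolding H_def R_def by auto
  have subV: "X \<subseteq> V" if "X \<in> F" for X using F(2) that by blast
  have meet: "card (A \<inter> B) = 4" if AB: "A \<in> H" "B \<in> H" "A \<noteq> B" for A B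
  proof -
    have L: "A \<in> layer 5 F" "B \<in> layer 5 F" using AB H_sub by auto
    have "2 \<le> card (A \<inter> B)"
      using card_Int_ge[OF Q(1) fin[of A], of B] HQ[OF AB(1)] HQ[OF AB(2)] Q(2) L by auto
    then show ?thesis using near_layer5_eq[OF F(1) L AB(3)] by simp
  qed
  have "card H \<le> max (4 + 2) (card V - 4)"
    using V(1) meet subV H_sub by (intro card_adjacent_family) auto
  then have H7: "card H \<le> 7" using V by simp
  show ?thesis
  proof (cases "4 \<le> card H")
    case True
    then obtain B where B: "B \<in> H" by fastforce
    have near: "2 \<le> card (X \<inter> B)" if X: "X \<in> R" for X
      using card_Int_ge[OF Q(1) fin[of X], of B] HQ[OF B] RQ[OF X] Q(2) X R_sub by auto
    have "card R \<le> max 5 (card V - 3)"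
    proof (rule card_four_sets_meeting_twice[OF V(1)])
      show "X \<subseteq> V \<and> card X = 4" if "X \<in> R" for X using that R_sub subV by auto
      show "2 < card (X \<inter> Y)" if "X \<in> R" "Y \<in> R" for X Y
        using four_sets_near_cluster[OF F(1) H_sub True meet _ B near _ B near] that R_sub by blast
    qed
    then show ?thesis using sum H7 V by simp
  next
    case False
    have "card R \<le> 10"
      using large_traces_le_10[OF F(1) R_sub _ V Q RQ] subV R_sub by blast
    then show ?thesis using sum False by linarith
  qed
qed

lemma compatible_family_card_le_26:
  assumes F: "compatible_family F" "F \<subseteq> Pow V" and V: "finite V" "card V = 11"
  shows "card F \<le> 26"
proof (cases "card (layer 5 F) \<le> 6")
  have finF: "finite F" using F(2) V(1) by (simp add: finite_subset)
  {
    case True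
    then show ?thesis
      using card_split_layers[OF F(1) finF] layer4_eleven_points[OF F V] by linarith
  next
    case False
    define L where "L = layer 5 F"
    have finL: "finite L" using finF unfolding L_def by simp
    have subV: "A \<subseteq> V" "card A = 5" if "A \<in> L" for A using F(2) that unfolding L_def by auto
    have eq4: "card (A \<inter> B) = 4" if "A \<in> L" "B \<in> L" "A \<noteq> B" "2 \<le> card (A \<inter> B)" for A B
      using near_layer5_eq[OF F(1), of A B] that unfolding L_def by auto
    have fin: "finite A" if "A \<in> L" for A using subV(1)[OF that] V(1) finite_subset by blast
    have "L \<noteq> {}" using False unfolding L_def by force
    then obtain A where A: "A \<in> L" by blast
    \<comment> \<open>The sets that are not near \<open>A\<close> are pairwise near, as there are no three pairwise far ones.\<close>
    define C1 where "C1 = {B \<in> L. 2 \<le> card (A \<inter> B)}"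
    define C2 where "C2 = L - C1"
    have near1: "card (B \<inter> B') = 4" if B: "B \<in> C1" "B' \<in> C1" "B \<noteq> B'" for B B'
    proof -
      have BL: "B \<in> L" "B' \<in> L" using B unfolding C1_def by auto
      have "4 \<le> card (A \<inter> B)" "4 \<le> card (A \<inter> B')"
        using compatible_near4[OF F(1), of A B] compatible_near4[OF F(1), of A B'] A B
        unfolding C1_def L_def by blast+
      moreover from this(1) have "4 \<le> card (B \<inter> A)" by (simp add: Int_commute)
      ultimately have "2 \<le> card (B \<inter> B')"
        using card_Int_triangle[OF fin[OF BL(1)] fin[OF A], of B'] subV(2)[OF A] by linarith
      then show ?thesis using eq4 BL B(3) by blast
    qed
    have near2: "card (B \<inter> B') = 4" if B: "B \<in> C2" "B' \<in> C2" "B \<noteq> B'" for B B'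
    proof -
      have BL: "B \<in> L" "B' \<in> L" "card (A \<inter> B) \<le> 1" "card (A \<inter> B') \<le> 1"
        using B unfolding C1_def C2_def by auto
      have "\<not> card (B \<inter> B') \<le> 1"
        using no_three_spread_blocks[OF V subV(1)[OF A] subV(1)[OF BL(1)] subV(1)[OF BL(2)]
            subV(2)[OF A] subV(2)[OF BL(1)] subV(2)[OF BL(2)] BL(3,4)] by blast
      then have "2 \<le> card (B \<inter> B')" by simp
      then show ?thesis using eq4 BL B(3) by blast
    qed
    have "card L = card C1 + card C2"
    proof -
      have "L = C1 \<union> C2" "C1 \<inter> C2 = {}" unfolding C2_def C1_def by auto
      then show ?thesis using finL by (metis card_Un_disjoint finite_Un)
    qed
    then have large: "4 \<le> card C1 \<or> 4 \<le> card C2" using False unfolding L_def by linarith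
    obtain C where C: "C \<subseteq> L" "4 \<le> card C"
      and near: "\<And>B B'. B \<in> C \<Longrightarrow> B' \<in> C \<Longrightarrow> B \<noteq> B' \<Longrightarrow> card (B \<inter> B') = 4"
    proof (cases "4 \<le> card C1")
      case True
      moreover have "C1 \<subseteq> L" unfolding C1_def by blast
      ultimately show thesis using that[of C1] near1 by simp
    next
      case False
      then have "4 \<le> card C2" using large by simp
      moreover have "C2 \<subseteq> L" unfolding C2_def by blast
      ultimately show thesis using that[of C2] near2 by simp
    qed
    have "C \<noteq> {}" using C(2) by auto
    have C5: "card B = Suc 4" if "B \<in> C" for B using subV(2) C(1) that by auto
    consider (core) D where "finite D" "card D = 4" "\<And>B. B \<in> C \<Longrightarrow> D \<subseteq> B"
      | (ball) K where "finite K" "card K = 4 + 2" "\<And>B. B \<in> C \<Longrightarrow> B \<subseteq> K"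
      using adjacent_family_cases[of C 4, OF C5 near \<open>C \<noteq> {}\<close>] by blast
    then show ?thesis
    proof cases
      case (core D)
      then have "C \<subseteq> {A \<in> layer 5 F. D \<subseteq> A}" using C(1) unfolding L_def by blast
      then show ?thesis using core_cluster_bound[OF F V core(1,2) _ C(2)] by blast
    next
      case (ball K)
      obtain B B' where B: "B \<in> C" "B' \<in> C" "B \<noteq> B'"
        using C(2) card_le_Suc0_iff_eq[of C] finite_subset[OF C(1) finL] by fastforce
      have BL: "B \<in> L" "B' \<in> L" using B C(1) by auto
      have "card (B \<union> B') = 6"
        using card_Un_Int[OF fin[OF BL(1)] fin[OF BL(2)]] near[OF B] subV(2)[OF BL(1)] subV(2)[OF BL(2)]
        by linarith
      then have "B \<union> B' = K" using ball B by (intro card_subset_eq) auto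
      then have "K \<subseteq> V" using subV(1) BL by blast
      moreover have "C \<subseteq> {A \<in> layer 5 F. A \<subseteq> K}" using C(1) ball(3) unfolding L_def by blast
      ultimately show ?thesis using ball_cluster_bound[OF F V ball(1) _ _ _ C(2)] ball(2) by simp
    qed
  }
qed

section \<open>From vertices to compatible families\<close>

abbreviation ground :: "nat set" where
  "ground \<equiv> {1..11}"

definition bipartition :: "nat set \<Rightarrow> nat set set" where
  "bipartition A = {A, ground - A}"

definition small_sets :: "nat set set" where
  "small_sets = {A. A \<subseteq> ground \<and> (card A = 4 \<or> card A = 5)}"

lemma small_setsD:
  assumes "A \<in> small_sets"
  shows "A \<subseteq> ground" "finite A" "card A = 4 \<or> card A = 5" "card (ground - A) = 11 - card A"
proof -
  show A: "A \<subseteq> ground" "card A = 4 \<or> card A = 5" using assms unfolding small_sets_def by auto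
  then show "finite A" using finite_subset by blast
  then show "card (ground - A) = 11 - card A" using A by (simp add: card_Diff_subset)
qed

lemma bipartition_disjoint:
  "P \<in> bipartition A \<Longrightarrow> P' \<in> bipartition A \<Longrightarrow> P \<noteq> P' \<Longrightarrow> P \<inter> P' = {}"
  unfolding bipartition_def by auto

text \<open>
  The complement of a small set has at least six points, so it is not small.
\<close>

lemma inj_bipartition: "inj_on bipartition small_sets"
proof (rule inj_onI)
  fix A B assume AB: "A \<in> small_sets" "B \<in> small_sets" "bipartition A = bipartition B"
  have "A \<noteq> ground - B" using small_setsD(3,4)[OF AB(1)] small_setsD(3,4)[OF AB(2)] by force
  then show "A = B" using AB(3) unfolding bipartition_def by blast
qed

lemma QI3_verts_eq: "QI3_verts 11 = bipartition ` small_sets"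
proof
  show "bipartition ` small_sets \<subseteq> QI3_verts 11"
  proof (intro subsetI, elim imageE)
    fix p A assume p: "p = bipartition A" and A: "A \<in> small_sets"
    note A' = small_setsD[OF A]
    have "A \<noteq> {}" "ground - A \<noteq> {}" "A \<noteq> ground - A" "4 \<le> card A" "4 \<le> card (ground - A)"
      using A' by (auto simp flip: card_0_eq)
    then show "p \<in> QI3_verts 11"
      using A'(1) unfolding p bipartition_def QI3_verts_def partition_on_def
      by (auto simp: disjoint_def)
  qed
  show "QI3_verts 11 \<subseteq> bipartition ` small_sets"
  proof
    fix p assume p: "p \<in> QI3_verts 11"
    then obtain P Q where PQ: "p = {P, Q}" "P \<noteq> Q" unfolding QI3_verts_def by (auto simp: card_2_iff)
    have part: "partition_on ground p" and four: "4 \<le> card P" "4 \<le> card Q"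
      using p PQ(1) unfolding QI3_verts_def by auto
    have un: "P \<union> Q = ground" "P \<inter> Q = {}"
      using part PQ unfolding partition_on_def disjoint_def by auto
    have fin: "finite P" "finite Q" using un(1) finite_Un[of P Q] by auto
    have sum: "card P + card Q = 11" using card_Un_disjoint[OF fin un(2)] un(1) by simp
    have Q: "Q = ground - P" "P = ground - Q" using un by blast+
    show "p \<in> bipartition ` small_sets"
    proof (cases "card P \<le> 5")
      case True
      then have "P \<in> small_sets" using un(1) four unfolding small_sets_def by auto
      moreover have "p = bipartition P" unfolding bipartition_def using PQ(1) Q(1) by simp
      ultimately show ?thesis by blast
    next
      case False
      then have "Q \<in> small_sets" using un(1) four sum unfolding small_sets_def by auto
      moreover have "p = bipartition Q"
        unfolding bipartition_def using PQ(1) Q(2) by (simp add: insert_commute)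
      ultimately show ?thesis by blast
    qed
  qed
qed

text \<open>
  With \<open>t = card (A \<inter> B)\<close> the other cells have \<open>card A - t\<close>, \<open>card B - t\<close> and
  \<open>11 + t - card A - card B\<close> points. The last number exceeds \<open>t\<close>, so it is too small only if \<open>t\<close> is
  too small.
\<close>

lemma all_four_intersections:
  assumes A: "A \<in> small_sets" and B: "B \<in> small_sets"
  shows "(\<forall>P\<in>bipartition A. \<forall>Q\<in>bipartition B. 2 \<le> card (P \<inter> Q)) \<longleftrightarrow>
    \<not> (card (A \<inter> B) \<le> 1 \<or> min (card A) (card B) \<le> Suc (card (A \<inter> B)))"
proof -
  note A' = small_setsD[OF A] and B' = small_setsD[OF B]
  define t where "t = card (A \<inter> B)"
  have "A - B = A \<inter> (ground - B)" "B - A = (ground - A) \<inter> B"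
    "ground - (A \<union> B) = (ground - A) \<inter> (ground - B)"
    using A'(1) B'(1) by blast+
  moreover have "card (A - B) + t = card A" "card (B - A) + t = card B"
    using A'(2) B'(2) card_Int_Diff[of A B] card_Int_Diff[of B A] unfolding t_def
    by (simp_all add: Int_commute)
  moreover have "card (ground - (A \<union> B)) + card (A \<union> B) = 11"
    using A'(1,2) B'(1,2) card_mono[of ground "A \<union> B"] by (simp add: card_Diff_subset)
  moreover have "card (A \<union> B) + t = card A + card B"
    using card_Un_Int[OF A'(2) B'(2)] unfolding t_def by simp
  ultimately have cells: "card (A \<inter> (ground - B)) + t = card A" "card ((ground - A) \<inter> B) + t = card B"
    "card ((ground - A) \<inter> (ground - B)) + (card A + card B) = 11 + t"
    by simp_all
  have "(\<forall>P\<in>bipartition A. \<forall>Q\<in>bipartition B. 2 \<le> card (P \<inter> Q)) \<longleftrightarrow>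
      2 \<le> t \<and> 2 \<le> card (A \<inter> (ground - B)) \<and> 2 \<le> card ((ground - A) \<inter> B) \<and>
      2 \<le> card ((ground - A) \<inter> (ground - B))"
    unfolding bipartition_def t_def by blast
  also have "\<dots> \<longleftrightarrow> 2 \<le> t \<and> t + 2 \<le> card A \<and> t + 2 \<le> card B"
    using cells A'(3) B'(3) by linarith
  also have "\<dots> \<longleftrightarrow> \<not> (t \<le> 1 \<or> min (card A) (card B) \<le> Suc t)"
    by linarith
  finally show ?thesis unfolding t_def .
qed

lemma qualitatively_independent3_two_points:
  assumes "qualitatively_independent3 p q r" "R \<in> r" "R' \<in> r" "R \<inter> R' = {}"
    and "P \<in> p" "Q \<in> q" "finite P"
  shows "2 \<le> card (P \<inter> Q)"
proof -
  have "P \<inter> Q \<inter> R \<noteq> {}" "P \<inter> Q \<inter> R' \<noteq> {}"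
    using assms unfolding qualitatively_independent3_def by simp_all
  then obtain x y where "x \<in> P \<inter> Q \<inter> R" "y \<in> P \<inter> Q \<inter> R'" by blast
  then have "{x, y} \<subseteq> P \<inter> Q" "x \<noteq> y" using assms(4) by auto
  then show ?thesis using card_mono[of "P \<inter> Q" "{x, y}"] assms(7) by simp
qed

lemma qualitatively_independent3_swap12:
  assumes "qualitatively_independent3 p q r"
  shows "qualitatively_independent3 q p r"
  unfolding qualitatively_independent3_def
proof (intro ballI)
  fix Q P R assume "Q \<in> q" "P \<in> p" "R \<in> r"
  then have "P \<inter> Q \<inter> R \<noteq> {}" using assms unfolding qualitatively_independent3_def by simp
  then show "Q \<inter> P \<inter> R \<noteq> {}" by (simp add: Int_commute)
qed

lemma qualitatively_independent3_swap23:
  assumes "qualitatively_independent3 p q r"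
  shows "qualitatively_independent3 p r q"
  unfolding qualitatively_independent3_def
proof (intro ballI)
  fix P R Q assume "P \<in> p" "R \<in> r" "Q \<in> q"
  then have "P \<inter> Q \<inter> R \<noteq> {}" using assms unfolding qualitatively_independent3_def by simp
  moreover have "P \<inter> R \<inter> Q = P \<inter> Q \<inter> R" by blast
  ultimately show "P \<inter> R \<inter> Q \<noteq> {}" by simp
qed

lemma QI3_edgeI:
  assumes "p \<in> QI3_verts n" "q \<in> QI3_verts n" "r \<in> QI3_verts n"
    and "p \<noteq> q" "p \<noteq> r" "q \<noteq> r" "qualitatively_independent3 p q r"
  shows "{p, q, r} \<in> QI3_edges n"
  using assms unfolding QI3_edges_def by blast

text \<open>
  A third partition independent of the two has a point of each of its classes in every cell.
  Conversely, choose two different points \<open>f\<close> and \<open>g\<close> of each cell; the four points chosen by \<open>f\<close>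
  form a class of a suitable third partition, because the points chosen by \<open>g\<close> are left for the
  other class.
\<close>

lemma common_edge_iff:
  assumes A: "A \<in> small_sets" and B: "B \<in> small_sets" and "A \<noteq> B"
  shows "(\<exists>e\<in>QI3_edges 11. bipartition A \<in> e \<and> bipartition B \<in> e) \<longleftrightarrow>
    (\<forall>P\<in>bipartition A. \<forall>Q\<in>bipartition B. 2 \<le> card (P \<inter> Q))"
proof
  have neq: "bipartition A \<noteq> bipartition B" using inj_bipartition A B \<open>A \<noteq> B\<close> by (auto dest: inj_onD)
  {
    assume "\<exists>e\<in>QI3_edges 11. bipartition A \<in> e \<and> bipartition B \<in> e"
    then obtain p q r where e: "bipartition A \<in> {p, q, r}" "bipartition B \<in> {p, q, r}"
      and V: "p \<in> QI3_verts 11" "q \<in> QI3_verts 11" "r \<in> QI3_verts 11"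
      and qi: "qualitatively_independent3 p q r"
      unfolding QI3_edges_def by blast
    note swap = qualitatively_independent3_swap12 qualitatively_independent3_swap23
    have perms: "qualitatively_independent3 p r q" "qualitatively_independent3 q p r"
      "qualitatively_independent3 q r p" "qualitatively_independent3 r p q"
      "qualitatively_independent3 r q p"
      using qi by (simp_all only: qi swap(2)[OF qi] swap(1)[OF qi] swap(2)[OF swap(1)[OF qi]]
          swap(1)[OF swap(2)[OF qi]] swap(1)[OF swap(2)[OF swap(1)[OF qi]]])
    have "\<exists>s\<in>QI3_verts 11. qualitatively_independent3 (bipartition A) (bipartition B) s"
      using e neq V qi perms by auto
    then obtain S where S: "S \<in> small_sets"
      "qualitatively_independent3 (bipartition A) (bipartition B) (bipartition S)"
      unfolding QI3_verts_eq by blast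
    have "S \<in> bipartition S" "ground - S \<in> bipartition S" unfolding bipartition_def by auto
    moreover have "finite P" if "P \<in> bipartition A" for P
      using that small_setsD(2)[OF A] unfolding bipartition_def by auto
    ultimately show "\<forall>P\<in>bipartition A. \<forall>Q\<in>bipartition B. 2 \<le> card (P \<inter> Q)"
      using qualitatively_independent3_two_points[OF S(2), of S "ground - S"] by blast
  next
    assume two: "\<forall>P\<in>bipartition A. \<forall>Q\<in>bipartition B. 2 \<le> card (P \<inter> Q)"
    have "\<exists>x y. x \<in> P \<inter> Q \<and> y \<in> P \<inter> Q \<and> x \<noteq> y" if "P \<in> bipartition A" "Q \<in> bipartition B" for P Q
    proof -
      have "2 \<le> card (P \<inter> Q)" using two that by simp
      then obtain e where "e \<subseteq> P \<inter> Q" "card e = 2" using obtain_subset_with_card_n by metis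
      then show ?thesis by (auto simp: card_2_iff)
    qed
    then obtain f g where fg: "\<And>P Q. P \<in> bipartition A \<Longrightarrow> Q \<in> bipartition B \<Longrightarrow>
        f P Q \<in> P \<inter> Q \<and> g P Q \<in> P \<inter> Q \<and> f P Q \<noteq> g P Q" by metis
    have in_bip: "A \<in> bipartition A" "ground - A \<in> bipartition A"
      "B \<in> bipartition B" "ground - B \<in> bipartition B" unfolding bipartition_def by auto
    define S where "S = {f A B, f A (ground - B), f (ground - A) B, f (ground - A) (ground - B)}"
    note cells = fg[OF in_bip(1,3)] fg[OF in_bip(1,4)] fg[OF in_bip(2,3)] fg[OF in_bip(2,4)]
    have "card S = 4"
    proof -
      have "f A B \<noteq> f A (ground - B)" "f A B \<noteq> f (ground - A) B" "f A B \<noteq> f (ground - A) (ground - B)"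
        "f A (ground - B) \<noteq> f (ground - A) B" "f A (ground - B) \<noteq> f (ground - A) (ground - B)"
        "f (ground - A) B \<noteq> f (ground - A) (ground - B)"
        using cells by (metis Diff_iff IntD1 IntD2)+
      then show ?thesis unfolding S_def by simp
    qed
    moreover have "S \<subseteq> ground"
      using cells small_setsD(1)[OF A] unfolding S_def by blast
    ultimately have S: "S \<in> small_sets" unfolding small_sets_def by simp
    have fS: "f P Q \<in> S" if "P \<in> bipartition A" "Q \<in> bipartition B" for P Q
      using that unfolding S_def bipartition_def by auto
    have gS: "g P Q \<in> ground - S" if P: "P \<in> bipartition A" and Q: "Q \<in> bipartition B" for P Q
    proof -
      have "g P Q \<noteq> f P' Q'" if P': "P' \<in> bipartition A" and Q': "Q' \<in> bipartition B" for P' Q'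
      proof (cases "P = P' \<and> Q = Q'")
        case True
        then show ?thesis using fg[OF P Q] by metis
      next
        case False
        then have "P \<inter> P' = {} \<or> Q \<inter> Q' = {}"
          using bipartition_disjoint[OF P P'] bipartition_disjoint[OF Q Q'] by blast
        moreover have "g P Q \<in> P \<inter> Q" "f P' Q' \<in> P' \<inter> Q'" using fg[OF P Q] fg[OF P' Q'] by simp_all
        ultimately show ?thesis by fastforce
      qed
      then have "g P Q \<notin> S" using in_bip unfolding S_def by blast
      moreover have "g P Q \<in> ground"
        using fg[OF P Q] P small_setsD(1)[OF A] unfolding bipartition_def by blast
      ultimately show ?thesis by blast
    qed
    have qi: "qualitatively_independent3 (bipartition A) (bipartition B) (bipartition S)"
      unfolding qualitatively_independent3_def
    proof (intro ballI)
      fix P Q R assume PQR: "P \<in> bipartition A" "Q \<in> bipartition B" "R \<in> bipartition S"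
      then have "f P Q \<in> P \<inter> Q \<inter> R \<or> g P Q \<in> P \<inter> Q \<inter> R"
        using fg[OF PQR(1,2)] fS[OF PQR(1,2)] gS[OF PQR(1,2)] unfolding bipartition_def[of S] by blast
      then show "P \<inter> Q \<inter> R \<noteq> {}" by blast
    qed
    have triple: "A \<inter> B \<inter> R \<noteq> {}" if "R \<in> bipartition S" for R
      using qi that in_bip(1,3) unfolding qualitatively_independent3_def by simp
    have neqS: "bipartition A \<noteq> bipartition S" "bipartition B \<noteq> bipartition S"
      using triple[of "ground - A"] triple[of "ground - B"] in_bip(2,4) by auto
    have verts: "bipartition A \<in> QI3_verts 11" "bipartition B \<in> QI3_verts 11"
      "bipartition S \<in> QI3_verts 11"
      using A B S unfolding QI3_verts_eq by simp_all
    have "{bipartition A, bipartition B, bipartition S} \<in> QI3_edges 11"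
      using verts neq neqS qi by (rule QI3_edgeI)
    then show "\<exists>e\<in>QI3_edges 11. bipartition A \<in> e \<and> bipartition B \<in> e"
      by (rule bexI[rotated]) simp
  }
qed

lemma strongly_independent_iff:
  assumes "F \<subseteq> small_sets"
  shows "strongly_independent (QI3 11) (bipartition ` F) \<longleftrightarrow> compatible_family F"
proof -
  have cards: "\<forall>A\<in>F. card A = 4 \<or> card A = 5" using assms small_setsD(3) by blast
  have eq_iff: "bipartition A = bipartition B \<longleftrightarrow> A = B" if "A \<in> F" "B \<in> F" for A B
    using inj_on_eq_iff[OF inj_bipartition, of A B] that assms by blast
  have "strongly_independent (QI3 11) (bipartition ` F) \<longleftrightarrow>
      (\<forall>e\<in>QI3_edges 11. \<forall>A\<in>F. \<forall>B\<in>F. bipartition A \<in> e \<longrightarrow> bipartition B \<in> e \<longrightarrow>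
        bipartition A = bipartition B)"
  proof -
    have "(\<forall>x\<in>e \<inter> f ` F. \<forall>y\<in>e \<inter> f ` F. x = y) \<longleftrightarrow>
        (\<forall>A\<in>F. \<forall>B\<in>F. f A \<in> e \<longrightarrow> f B \<in> e \<longrightarrow> f A = f B)" for e and f :: "nat set \<Rightarrow> nat set set"
      by blast
    then show ?thesis
      using image_mono[OF assms, of bipartition]
      unfolding strongly_independent_def QI3_def fst_conv snd_conv QI3_verts_eq by simp
  qed
  also have "\<dots> \<longleftrightarrow>
      (\<forall>A\<in>F. \<forall>B\<in>F. A \<noteq> B \<longrightarrow> \<not> (\<exists>e\<in>QI3_edges 11. bipartition A \<in> e \<and> bipartition B \<in> e))"
    using eq_iff by metis
  also have "\<dots> \<longleftrightarrow> (\<forall>A\<in>F. \<forall>B\<in>F. A \<noteq> B \<longrightarrow>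
      card (A \<inter> B) \<le> 1 \<or> min (card A) (card B) \<le> Suc (card (A \<inter> B)))"
  proof (intro ball_cong refl imp_cong)
    fix A B assume "A \<in> F" "B \<in> F" "A \<noteq> B"
    then show "(\<not> (\<exists>e\<in>QI3_edges 11. bipartition A \<in> e \<and> bipartition B \<in> e)) \<longleftrightarrow>
        card (A \<inter> B) \<le> 1 \<or> min (card A) (card B) \<le> Suc (card (A \<inter> B))"
      using common_edge_iff[of A B] all_four_intersections[of A B] subsetD[OF assms] by simp
  qed
  finally show ?thesis using cards unfolding compatible_family_def by simp
qed

lemma strongly_independent_card_le:
  assumes "strongly_independent (QI3 11) U"
  shows "card U \<le> 26"
proof -
  have "U \<subseteq> bipartition ` small_sets"
    using assms unfolding strongly_independent_def QI3_def QI3_verts_eq by simp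
  then obtain F where F: "F \<subseteq> small_sets" "U = bipartition ` F" by (meson subset_image_iff)
  have "F \<subseteq> Pow ground" using F(1) small_setsD(1) by blast
  moreover have "compatible_family F" using strongly_independent_iff[OF F(1)] F(2) assms by simp
  ultimately have "card F \<le> 26" by (intro compatible_family_card_le_26) auto
  moreover have "finite F" using \<open>F \<subseteq> Pow ground\<close> by (simp add: finite_subset)
  ultimately show ?thesis using F(2) card_image_le[of F bipartition] by auto
qed

section \<open>A family of 26 sets\<close>

text \<open>
  Both cases of the upper bound at once, with core \<open>{1,2,3,4}\<close> and ball \<open>{5..10}\<close>. Four-element
  subsets of the ball are near only if the pairs that they omit share a point; here that point is 5.
\<close>

definition extremal_family :: "nat set set" where
  "extremal_family = (\<lambda>x. {1, 2, 3, x}) ` {4..11} \<union> (\<lambda>x. {1, 2, 3, 4, x}) ` {5..11} \<union>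
     {A. A \<subseteq> {5..10} \<and> card A = 5} \<union> {A. A \<subseteq> {6..10} \<and> card A = 4}"

lemma extremal_family:
  shows "extremal_family \<subseteq> small_sets" "compatible_family extremal_family"
    "card extremal_family = 26"
proof -
  define S4 S5 K5 L4 :: "nat set set" where
    "S4 = (\<lambda>x. {1, 2, 3, x}) ` {4..11}" and "S5 = (\<lambda>x. {1, 2, 3, 4, x}) ` {5..11}" and
    "K5 = {A. A \<subseteq> {5..10} \<and> card A = 5}" and "L4 = {A. A \<subseteq> {6..10} \<and> card A = 4}"
  have fam: "extremal_family = S4 \<union> S5 \<union> K5 \<union> L4"
    unfolding extremal_family_def S4_def S5_def K5_def L4_def ..
  have cards: "A \<in> S4 \<Longrightarrow> card A = 4" "A \<in> S5 \<Longrightarrow> card A = 5"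
    "A \<in> K5 \<Longrightarrow> card A = 5" "A \<in> L4 \<Longrightarrow> card A = 4" for A
    unfolding S4_def S5_def K5_def L4_def by auto
  have subs: "A \<in> K5 \<union> L4 \<Longrightarrow> A \<subseteq> {5..10}" "A \<in> S4 \<union> S5 \<Longrightarrow> {1, 2, 3} \<subseteq> A"
    "A \<in> S4 \<union> S5 \<union> K5 \<union> L4 \<Longrightarrow> A \<subseteq> ground" for A
    unfolding S4_def S5_def K5_def L4_def by auto
  have fin: "finite A" if "A \<in> S4 \<union> S5 \<union> K5 \<union> L4" for A
    using subs(3)[OF that] finite_subset by blast
  show "extremal_family \<subseteq> small_sets" unfolding fam small_sets_def using cards subs(3) by blast
  have star: "min (card A) (card B) \<le> Suc (card (A \<inter> B))" if AB: "A \<in> S4 \<union> S5" "B \<in> S4 \<union> S5" for A B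
  proof (cases "A \<in> S5 \<and> B \<in> S5")
    case True
    then have "{1, 2, 3, 4} \<subseteq> A \<inter> B" unfolding S5_def by auto
    then have "card {1, 2, 3, 4::nat} \<le> card (A \<inter> B)" using fin[of A] AB by (intro card_mono) auto
    then show ?thesis using True cards by simp
  next
    case False
    have "{1, 2, 3} \<subseteq> A \<inter> B" using subs(2) AB by blast
    then have "card {1, 2, 3::nat} \<le> card (A \<inter> B)" using fin[of A] AB by (intro card_mono) auto
    moreover have "card A = 4 \<or> card B = 4" using False AB cards by blast
    ultimately show ?thesis by auto
  qed
  have ball: "min (card A) (card B) \<le> Suc (card (A \<inter> B))" if AB: "A \<in> K5 \<union> L4" "B \<in> K5 \<union> L4" for A B
  proof -
    have "card A + card B \<le> card K + card (A \<inter> B)" if "A \<subseteq> K" "B \<subseteq> K" "finite K" for K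
      using card_Int_ge[of K A B] fin[of A] AB that by (simp add: Int_absorb2)
    from this[of "{5..10}"] this[of "{6..10}"] show ?thesis
      using subs(1)[OF AB(1)] subs(1)[OF AB(2)] AB unfolding K5_def L4_def by auto
  qed
  have cross: "card (A \<inter> B) \<le> 1" if AB: "A \<in> S4 \<union> S5" "B \<in> K5 \<union> L4" for A B
  proof -
    obtain x where "A \<subseteq> {1, 2, 3, 4, x}" using AB(1) unfolding S4_def S5_def by blast
    then have "A \<inter> B \<subseteq> {x}" using subs(1)[OF AB(2)] by fastforce
    then show ?thesis using card_mono[of "{x}" "A \<inter> B"] by simp
  qed
  show "compatible_family extremal_family"
    unfolding compatible_family_def fam
  proof (intro conjI ballI impI)
    show "card A = 4 \<or> card A = 5" if "A \<in> S4 \<union> S5 \<union> K5 \<union> L4" for A using that cards by blast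
    show "card (A \<inter> B) \<le> 1 \<or> min (card A) (card B) \<le> Suc (card (A \<inter> B))"
      if "A \<in> S4 \<union> S5 \<union> K5 \<union> L4" "B \<in> S4 \<union> S5 \<union> K5 \<union> L4" for A B
      using star[of A B] ball[of A B] cross[of A B] cross[of B A] that by (auto simp: Int_commute)
  qed
  have "inj_on (\<lambda>x::nat. {1, 2, 3, x}) {4..11}"
  proof (rule inj_onI)
    fix x y :: nat assume xy: "x \<in> {4..11}" "{1, 2, 3, x} = {1, 2, 3, y}"
    then have "x \<in> {1, 2, 3, y}" by blast
    then show "x = y" using xy(1) by auto
  qed
  then have c1: "card S4 = 8" unfolding S4_def by (simp add: card_image)
  have "inj_on (\<lambda>x::nat. {1, 2, 3, 4, x}) {5..11}"
  proof (rule inj_onI)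
    fix x y :: nat assume xy: "x \<in> {5..11}" "{1, 2, 3, 4, x} = {1, 2, 3, 4, y}"
    then have "x \<in> {1, 2, 3, 4, y}" by blast
    then show "x = y" using xy(1) by auto
  qed
  then have c2: "card S5 = 7" unfolding S5_def by (simp add: card_image)
  have c3: "card K5 = 6" unfolding K5_def by (simp add: n_subsets numeral_eq_Suc)
  have c4: "card L4 = 5" unfolding L4_def by (simp add: n_subsets numeral_eq_Suc)
  have finite4: "finite S4" "finite S5" "finite K5" "finite L4"
    unfolding S4_def S5_def K5_def L4_def by auto
  have "A \<notin> S5" if "A \<in> S4" for A using cards(1)[OF that] cards(2)[of A] by auto
  moreover have "A \<notin> L4" if "A \<in> K5" for A using cards(3)[OF that] cards(4)[of A] by auto
  moreover have "A \<notin> K5 \<union> L4" if "A \<in> S4 \<union> S5" for A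
  proof
    assume "A \<in> K5 \<union> L4"
    then have "{1, 2, 3} \<subseteq> {5..10::nat}" using subs(1)[of A] subs(2)[OF that] by (meson subset_trans)
    then show False by simp
  qed
  ultimately have "S4 \<inter> S5 = {}" "K5 \<inter> L4 = {}" "(S4 \<union> S5) \<inter> (K5 \<union> L4) = {}" by blast+
  then have "card ((S4 \<union> S5) \<union> (K5 \<union> L4)) = 26"
    using finite4 c1 c2 c3 c4 by (simp add: card_Un_disjoint)
  then show "card extremal_family = 26" unfolding fam by (simp add: Un_assoc)
qed

section \<open>Strong colourings\<close>

lemma card_QI3_verts: "card (QI3_verts 11) = 792"
proof -
  have "small_sets = {A. A \<subseteq> ground \<and> card A = 4} \<union> {A. A \<subseteq> ground \<and> card A = 5}"
    unfolding small_sets_def by blast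
  also have "card \<dots> = card {A. A \<subseteq> ground \<and> card A = 4} + card {A. A \<subseteq> ground \<and> card A = 5}"
    by (intro card_Un_disjoint) auto
  also have "\<dots> = (11 choose 4) + (11 choose 5)" by (simp add: n_subsets)
  also have "\<dots> = 792" by (simp add: numeral_eq_Suc)
  finally show ?thesis unfolding QI3_verts_eq using card_image[OF inj_bipartition] by simp
qed

text \<open>
  Colour classes are strongly independent, so each has at most 26 vertices.
\<close>

lemma strong_colouring_card_le:
  assumes "strong_colouring (QI3 11) k \<C>"
  shows "card (QI3_verts 11) \<le> 26 * k"
proof -
  note col = assms[unfolded strong_colouring_def QI3_def fst_conv snd_conv]
  have part: "partition_on (QI3_verts 11) \<C>" by (rule conjunct1[OF col])
  have card_C: "card \<C> = k" by (rule conjunct1[OF conjunct2[OF conjunct2[OF col]]])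
  have edge: "\<forall>e\<in>QI3_edges 11. \<forall>x\<in>e. \<forall>y\<in>e. x \<noteq> y \<longrightarrow> \<not> (\<exists>C\<in>\<C>. x \<in> C \<and> y \<in> C)"
    by (rule conjunct2[OF conjunct2[OF conjunct2[OF col]]])
  have "strongly_independent (QI3 11) C" if C: "C \<in> \<C>" for C
    unfolding strongly_independent_def
  proof (intro conjI ballI)
    show "C \<subseteq> fst (QI3 11)" using partition_onD1[OF part] C unfolding QI3_def by auto
    show "x = y" if "e \<in> snd (QI3 11)" "x \<in> e \<inter> C" "y \<in> e \<inter> C" for e x y
    proof (rule ccontr)
      assume "x \<noteq> y"
      moreover have "snd (QI3 11) = QI3_edges 11" unfolding QI3_def by simp
      ultimately have "\<not> (\<exists>C\<in>\<C>. x \<in> C \<and> y \<in> C)" using edge that by blast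
      then show False using that C by blast
    qed
  qed
  then have "card C \<le> 26" if "C \<in> \<C>" for C using strongly_independent_card_le that by blast
  then have "(\<Sum>C\<in>\<C>. card C) \<le> (\<Sum>C\<in>\<C>. 26)" by (intro sum_mono)
  moreover have "card (QI3_verts 11) \<le> (\<Sum>C\<in>\<C>. card C)"
    using partition_onD1[OF part] card_Union_le_sum_card[of \<C>] by simp
  ultimately show ?thesis using card_C by (simp add: mult.commute)
qed

text \<open>
  Giving every vertex its own colour; it shows that the minimum in the chromatic number is attained.
\<close>

lemma strong_colouring_exists:
  assumes "finite (verts H)"
  shows "\<exists>\<C>. strong_colouring H (card (verts H)) \<C>"
proof
  have "partition_on (verts H) ((\<lambda>x. {x}) ` verts H)"
    unfolding partition_on_def disjoint_def by auto
  then show "strong_colouring H (card (verts H)) ((\<lambda>x. {x}) ` verts H)"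
    unfolding strong_colouring_def using assms by (auto simp: card_image)
qed

theorem theorem2:
  shows "strong_independence_number (QI3 11) = 26 \<and> strong_chromatic_number (QI3 11) \<ge> 31"
proof
  define N where "N = {card U | U. strongly_independent (QI3 11) U}"
  have "n \<le> 26" if "n \<in> N" for n using that strongly_independent_card_le unfolding N_def by blast
  moreover from this have "finite N" by (auto intro: finite_subset[of N "{..26}"])
  moreover have "26 \<in> N"
  proof -
    have "strongly_independent (QI3 11) (bipartition ` extremal_family)"
      using strongly_independent_iff extremal_family(1,2) by blast
    moreover have "card (bipartition ` extremal_family) = 26"
      using card_image[OF inj_on_subset[OF inj_bipartition extremal_family(1)]] extremal_family(3) by simp
    ultimately show ?thesis unfolding N_def by force
  qed
  ultimately show "strong_independence_number (QI3 11) = 26"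
    unfolding strong_independence_number_def N_def[symmetric] by (intro Max_eqI)
  have "finite (verts (QI3 11))"
    using card_QI3_verts card_ge_0_finite[of "QI3_verts 11"] unfolding QI3_def by simp
  then have "\<exists>k \<C>. strong_colouring (QI3 11) k \<C>" using strong_colouring_exists by blast
  then have "\<exists>\<C>. strong_colouring (QI3 11) (strong_chromatic_number (QI3 11)) \<C>"
    unfolding strong_chromatic_number_def by (rule LeastI_ex)
  then have "792 \<le> 26 * strong_chromatic_number (QI3 11)"
    using strong_colouring_card_le card_QI3_verts by metis
  then show "strong_chromatic_number (QI3 11) \<ge> 31" by linarith
qed

end
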